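(* For each integer $n\ge 1$ let $P_n$ be the finite presentation \[ P_{n}=\Big\langle\, x_{\eta}\ \big(\eta \in \textstyle\bigcup_{i=0}^{n-1} \{0,1\}^{i}\big)\ \Big|\ x_{\eta}^{3}=e\ \ \forall \eta \in \{0,1\}^{n-1},\quad x_{\eta 0}x_{\eta 1}=x_{\eta}^{3}\ \ \forall \eta \in \textstyle\bigcup_{i=0}^{n-2} \{0,1\}^{i}\,\Big\rangle , \] and let $P_0=\langle\ \mid\ \rangle$ be the empty presentation of the trivial group. Write $\overline{P}_n$ for the group presented by $P_n$. Then for every $n\ge 1$: (1) $\overline{P}_{n}/\mathrm{Tor}_{1}(\overline{P}_{n}) \cong \overline{P}_{n-1}$; (2) $\mathrm{TorLen}(\overline{P}_{n})=n$. Moreover $P_n$ has $2^n-1$ generators and $2^n-1$ relators.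
   Context: $\{0,1\}^i$ denotes the set of binary strings of length exactly $i$, with $\{0,1\}^0=\{\emptyset\}$ (the empty string); for a string $\eta$, $\eta0$ and $\eta1$ denote the strings obtained by appending $0$ or $1$ on the right. For a group $G$, $\mathrm{Tor}(G)$ is the set of elements of finite order. Define $\mathrm{Tor}_0(G)=\{e\}$ and inductively $\mathrm{Tor}_{i+1}(G)$ to be the normal closure in $G$ of $\{g\in G : g\,\mathrm{Tor}_i(G)\text{ has finite order in } G/\mathrm{Tor}_i(G)\}$; set $\mathrm{Tor}_\infty(G)=\bigcup_{i\in\mathbb{N}}\mathrm{Tor}_i(G)$. The torsion length $\mathrm{TorLen}(G)$ is the smallest $n\ge 0$ with $\mathrm{Tor}_n(G)=\mathrm{Tor}_\infty(G)$ (equivalently $\mathrm{Tor}_n(G)=\mathrm{Tor}_{n+1}(G)$), and $\mathrm{TorLen}(G)=\infty$ if no such $n$ exists. *)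

theory Defs
  imports "HOL-Algebra.Algebra" "HOL-Library.Extended_Nat"
begin

text \<open>Words over an alphabet of generators: a letter is (x, True) for x and
(x, False) for x inverse.\<close>

type_synonym 'a word = "('a \<times> bool) list"

inductive pres_eq :: "'a word set \<Rightarrow> 'a word \<Rightarrow> 'a word \<Rightarrow> bool" for Rs where
  pres_refl: "pres_eq Rs w w"
| pres_sym: "pres_eq Rs u v \<Longrightarrow> pres_eq Rs v u"
| pres_trans: "pres_eq Rs u v \<Longrightarrow> pres_eq Rs v w \<Longrightarrow> pres_eq Rs u w"
| pres_cancel: "pres_eq Rs (u @ [(x, b), (x, \<not> b)] @ v) (u @ v)"
| pres_rel: "r \<in> Rs \<Longrightarrow> pres_eq Rs (u @ r @ v) (u @ v)"

definition pres_class :: "'a set \<Rightarrow> 'a word set \<Rightarrow> 'a word \<Rightarrow> 'a word set" where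
  "pres_class Xs Rs w = {v. v \<in> lists (Xs \<times> UNIV) \<and> pres_eq Rs v w}"

definition presented_group :: "'a set \<Rightarrow> 'a word set \<Rightarrow> 'a word set monoid" where
  "presented_group Xs Rs =
     \<lparr> carrier = pres_class Xs Rs ` lists (Xs \<times> UNIV),
       monoid.mult = (\<lambda>A B. \<Union>{pres_class Xs Rs (u @ v) | u v. u \<in> A \<and> v \<in> B}),
       monoid.one = pres_class Xs Rs [] \<rparr>"

text \<open>Generators x_eta, eta a binary string (bool list, appending on the right)
of length at most n-1.\<close>
definition P_gens :: "nat \<Rightarrow> bool list set" where
  "P_gens n = {\<eta>. length \<eta> < n}"

definition gen :: "'a \<Rightarrow> 'a word" where "gen x = [(x, True)]"
definition gen_inv :: "'a \<Rightarrow> 'a word" where "gen_inv x = [(x, False)]"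

definition P_rels :: "nat \<Rightarrow> bool list word set" where
  "P_rels n =
     {gen \<eta> @ gen \<eta> @ gen \<eta> | \<eta>. length \<eta> + 1 = n}
   \<union> {gen (\<eta> @ [False]) @ gen (\<eta> @ [True]) @ gen_inv \<eta> @ gen_inv \<eta> @ gen_inv \<eta>
       | \<eta>. length \<eta> + 2 \<le> n}"

definition P_group :: "nat \<Rightarrow> bool list word set monoid" where
  "P_group n = presented_group (P_gens n) (P_rels n)"

definition finite_order :: "('a, 'b) monoid_scheme \<Rightarrow> 'a \<Rightarrow> bool" where
  "finite_order G g \<longleftrightarrow> (\<exists>k::nat. k > 0 \<and> g [^]\<^bsub>G\<^esub> k = \<one>\<^bsub>G\<^esub>)"

definition normal_closure :: "('a, 'b) monoid_scheme \<Rightarrow> 'a set \<Rightarrow> 'a set" where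
  "normal_closure G S = \<Inter>{N. N \<lhd> G \<and> S \<subseteq> N}"

fun Tor :: "('a, 'b) monoid_scheme \<Rightarrow> nat \<Rightarrow> 'a set" where
  "Tor G 0 = {\<one>\<^bsub>G\<^esub>}"
| "Tor G (Suc i) = normal_closure G
      {g \<in> carrier G. finite_order (G Mod (Tor G i)) (Tor G i #>\<^bsub>G\<^esub> g)}"

definition Tor_inf :: "('a, 'b) monoid_scheme \<Rightarrow> 'a set" where
  "Tor_inf G = (\<Union>i. Tor G i)"

definition TorLen :: "('a, 'b) monoid_scheme \<Rightarrow> enat" where
  "TorLen G = (if \<exists>n. Tor G n = Tor_inf G
               then enat (LEAST n. Tor G n = Tor_inf G) else \<infinity>)"

end

theory Submission
  imports Defs
begin

text \<open>The group \<open>P\<^sub>n\<close> is built from the trivial group by adding the generators one at a time,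
  descendants first. Each step adjoins a cube root \<open>x\<close> of an element \<open>g\<close>: either \<open>g\<close> is trivial (a
  leaf), or \<open>g = x\<^sub>\<eta>\<^sub>0 x\<^sub>\<eta>\<^sub>1\<close> has infinite order, as is seen by sending the two factors to rotations
  of order three of the plane whose product is a translation. Adjoining a cube root is an
  amalgamated product over \<open>\<langle>g\<rangle> = \<langle>x\<^sup>3\<rangle>\<close>; letting it act on normal forms shows that reduced words
  are nontrivial, so an element of finite order is conjugate into the old group or into \<open>\<langle>x\<rangle>\<close>.
  Hence \<open>Tor\<^sub>1(P\<^sub>n)\<close> is the normal closure of the leaves, and killing the leaves turns \<open>P\<^sub>n\<close> into
  \<open>P\<^sub>n\<^sub>-\<^sub>1\<close>. Since \<open>Tor\<^sub>i\<^sub>+\<^sub>1(P\<^sub>n)\<close> is the preimage of \<open>Tor\<^sub>i(P\<^sub>n\<^sub>-\<^sub>1)\<close> and \<open>P\<^sub>n\<close> is nontrivial for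
  \<open>n \<ge> 1\<close>, the torsion length is \<open>n\<close>.\<close>

declare in_listsI [rule del] in_listsD [rule del]

section \<open>Presented groups\<close>

abbreviation words_on :: "'a set \<Rightarrow> 'a word set" where
  "words_on Xs \<equiv> lists (Xs \<times> UNIV)"

definition word_inv :: "'a word \<Rightarrow> 'a word" where
  "word_inv w = map (\<lambda>(x, b). (x, \<not> b)) (rev w)"

lemma word_inv_words_on [simp]: "w \<in> words_on Xs \<Longrightarrow> word_inv w \<in> words_on Xs"
  by (fastforce simp: word_inv_def in_lists_conv_set)

lemma word_inv_word_inv [simp]: "word_inv (word_inv w) = w"
  by (induction w) (auto simp: word_inv_def rev_map)

lemma pres_eq_context:
  assumes "pres_eq Rs u v" shows "pres_eq Rs (a @ u @ b) (a @ v @ b)"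
  using assms
proof (induction rule: pres_eq.induct)
  case (pres_cancel u x c v)
  show ?case using pres_eq.pres_cancel[of Rs "a @ u" x c "v @ b"] by simp
next
  case (pres_rel r u v)
  then show ?case using pres_eq.pres_rel[of r Rs "a @ u" "v @ b"] by simp
qed (auto intro: pres_eq.intros)

lemma pres_eq_append:
  assumes "pres_eq Rs u u'" "pres_eq Rs v v'" shows "pres_eq Rs (u @ v) (u' @ v')"
  using pres_eq_context[OF assms(1), of "[]" v] pres_eq_context[OF assms(2), of u' "[]"]
  by (auto intro: pres_trans)

lemma pres_eq_relator: "r \<in> Rs \<Longrightarrow> pres_eq Rs r []"
  using pres_rel[of r Rs "[]" "[]"] by simp

lemma pres_eq_word_inv_right: "pres_eq Rs (w @ word_inv w) []"
proof (induction w)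
  case Nil then show ?case by (simp add: word_inv_def pres_refl)
next
  case (Cons l w)
  obtain x b where l: "l = (x, b)" by force
  have "pres_eq Rs ([l] @ (w @ word_inv w) @ [(x, \<not> b)]) ([l] @ [] @ [(x, \<not> b)])"
    by (rule pres_eq_context[OF Cons.IH])
  moreover have "pres_eq Rs ([l] @ [] @ [(x, \<not> b)]) []"
    using pres_cancel[of Rs "[]" x b "[]"] l by simp
  ultimately show ?case using l by (auto simp: word_inv_def intro: pres_trans)
qed

lemma pres_eq_word_inv_left: "pres_eq Rs (word_inv w @ w) []"
  using pres_eq_word_inv_right[of Rs "word_inv w"] by simp

lemma pres_class_eq_iff:
  assumes "u \<in> words_on Xs"
  shows "pres_class Xs Rs u = pres_class Xs Rs v \<longleftrightarrow> pres_eq Rs u v"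
proof
  assume "pres_class Xs Rs u = pres_class Xs Rs v"
  moreover have "u \<in> pres_class Xs Rs u" using assms by (simp add: pres_class_def pres_refl)
  ultimately show "pres_eq Rs u v" by (simp add: pres_class_def)
next
  assume "pres_eq Rs u v"
  then show "pres_class Xs Rs u = pres_class Xs Rs v"
    unfolding pres_class_def by (blast intro: pres_trans pres_sym)
qed

lemma presented_group_carrier:
  "carrier (presented_group Xs Rs) = pres_class Xs Rs ` words_on Xs"
  by (simp add: presented_group_def)

lemma presented_group_one: "\<one>\<^bsub>presented_group Xs Rs\<^esub> = pres_class Xs Rs []"
  by (simp add: presented_group_def)

lemma pres_class_in_carrier [simp]:
  "w \<in> words_on Xs \<Longrightarrow> pres_class Xs Rs w \<in> carrier (presented_group Xs Rs)"
  by (simp add: presented_group_carrier)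

text \<open>The product is a union over all pairs of representatives; as \<open>pres_eq\<close> is a
  congruence, every pair gives the same class.\<close>

lemma presented_group_mult:
  assumes "u \<in> words_on Xs" "v \<in> words_on Xs"
  shows "pres_class Xs Rs u \<otimes>\<^bsub>presented_group Xs Rs\<^esub> pres_class Xs Rs v = pres_class Xs Rs (u @ v)"
proof -
  have "pres_class Xs Rs (u' @ v') = pres_class Xs Rs (u @ v)"
    if "u' \<in> pres_class Xs Rs u" "v' \<in> pres_class Xs Rs v" for u' v'
    using that by (subst pres_class_eq_iff) (auto simp: pres_class_def intro: pres_eq_append)
  moreover have "u \<in> pres_class Xs Rs u" "v \<in> pres_class Xs Rs v"
    using assms by (simp_all add: pres_class_def pres_refl)
  ultimately have "{pres_class Xs Rs (u' @ v') |u' v'.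
      u' \<in> pres_class Xs Rs u \<and> v' \<in> pres_class Xs Rs v} = {pres_class Xs Rs (u @ v)}"
    by blast
  then show ?thesis by (simp add: presented_group_def)
qed

lemma presented_groupE:
  assumes "x \<in> carrier (presented_group Xs Rs)"
  obtains w where "w \<in> words_on Xs" "x = pres_class Xs Rs w"
  using assms by (auto simp: presented_group_carrier)

lemma presented_group_is_group: "group (presented_group Xs Rs)"
proof (rule groupI)
  let ?G = "presented_group Xs Rs"
  fix x assume x: "x \<in> carrier ?G"
  then obtain u where u: "u \<in> words_on Xs" "x = pres_class Xs Rs u" by (rule presented_groupE)
  show "\<one>\<^bsub>?G\<^esub> \<otimes>\<^bsub>?G\<^esub> x = x"
    using u by (simp add: presented_group_mult presented_group_one)
  have "pres_class Xs Rs (word_inv u) \<otimes>\<^bsub>?G\<^esub> x = \<one>\<^bsub>?G\<^esub>"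
    using u by (simp add: presented_group_mult presented_group_one pres_class_eq_iff pres_eq_word_inv_left)
  moreover have "pres_class Xs Rs (word_inv u) \<in> carrier ?G"
    using u by simp
  ultimately show "\<exists>y\<in>carrier ?G. y \<otimes>\<^bsub>?G\<^esub> x = \<one>\<^bsub>?G\<^esub>" by blast
  fix y assume "y \<in> carrier ?G"
  then obtain v where v: "v \<in> words_on Xs" "y = pres_class Xs Rs v" by (rule presented_groupE)
  show "x \<otimes>\<^bsub>?G\<^esub> y \<in> carrier ?G"
    using u v by (simp add: presented_group_mult)
  fix z assume "z \<in> carrier ?G"
  then obtain w where w: "w \<in> words_on Xs" "z = pres_class Xs Rs w" by (rule presented_groupE)
  show "x \<otimes>\<^bsub>?G\<^esub> y \<otimes>\<^bsub>?G\<^esub> z = x \<otimes>\<^bsub>?G\<^esub> (y \<otimes>\<^bsub>?G\<^esub> z)"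
    using u v w by (simp add: presented_group_mult)
qed (simp add: presented_group_one)

lemma presented_group_inv:
  assumes "w \<in> words_on Xs"
  shows "inv\<^bsub>presented_group Xs Rs\<^esub> (pres_class Xs Rs w) = pres_class Xs Rs (word_inv w)"
proof -
  interpret group "presented_group Xs Rs" by (rule presented_group_is_group)
  show ?thesis using assms
    by (intro inv_equality)
      (simp_all add: presented_group_mult presented_group_one pres_class_eq_iff pres_eq_word_inv_left)
qed

section \<open>Evaluation of words and the universal property of a presentation\<close>

fun word_eval :: "('k, 'm) monoid_scheme \<Rightarrow> ('a \<Rightarrow> 'k) \<Rightarrow> 'a word \<Rightarrow> 'k" where
  "word_eval K f [] = \<one>\<^bsub>K\<^esub>"
| "word_eval K f ((x, b) # w) = (if b then f x else inv\<^bsub>K\<^esub> f x) \<otimes>\<^bsub>K\<^esub> word_eval K f w"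

context group
begin

lemma word_eval_closed [simp]: "range f \<subseteq> carrier G \<Longrightarrow> word_eval G f w \<in> carrier G"
proof (induction w)
  case (Cons l w)
  then have "f x \<in> carrier G" for x by auto
  with Cons show ?case by (cases l) auto
qed auto

lemma word_eval_append:
  "range f \<subseteq> carrier G \<Longrightarrow> word_eval G f (u @ v) = word_eval G f u \<otimes> word_eval G f v"
proof (induction u)
  case (Cons l u)
  then have "f x \<in> carrier G" for x by auto
  with Cons show ?case by (cases l) (auto simp: m_assoc)
qed auto

lemma word_eval_cong:
  "w \<in> words_on Xs \<Longrightarrow> (\<And>x. x \<in> Xs \<Longrightarrow> f x = f' x) \<Longrightarrow> word_eval G f w = word_eval G f' w"
  by (induction w) auto

text \<open>A derivation may insert and cancel letters outside the generating set, so
  \<open>f\<close> has to take values in the group on every letter. Later assignments carry a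
  default value one for this reason.\<close>

lemma word_eval_pres_eq:
  assumes "pres_eq Rs u v" "range f \<subseteq> carrier G" "\<And>r. r \<in> Rs \<Longrightarrow> word_eval G f r = \<one>"
  shows "word_eval G f u = word_eval G f v"
  using assms
proof (induction rule: pres_eq.induct)
  case (pres_cancel u x b v)
  then have "f x \<in> carrier G" by auto
  then have "word_eval G f [(x, b), (x, \<not> b)] = \<one>" by auto
  then show ?case using pres_cancel by (simp add: word_eval_append del: word_eval.simps append.simps)
next
  case (pres_rel r u v)
  then show ?case by (simp add: word_eval_append)
qed auto

end

text \<open>Von Dyck's homomorphism, read off an arbitrary representative; the choice does not
  matter once all relators evaluate to one.\<close>

definition pres_hom :: "('k, 'm) monoid_scheme \<Rightarrow> ('a \<Rightarrow> 'k) \<Rightarrow> 'a word set \<Rightarrow> 'k" where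
  "pres_hom K f A = word_eval K f (SOME w. w \<in> A)"

context
  fixes K :: "('k, 'm) monoid_scheme" and f :: "'a \<Rightarrow> 'k" and Rs :: "'a word set"
  assumes K: "group K" and f: "range f \<subseteq> carrier K"
    and rels: "\<And>r. r \<in> Rs \<Longrightarrow> word_eval K f r = \<one>\<^bsub>K\<^esub>"
begin

interpretation K: group K by (rule K)

lemma pres_hom_class:
  assumes "w \<in> words_on Xs" shows "pres_hom K f (pres_class Xs Rs w) = word_eval K f w"
proof -
  have "w \<in> pres_class Xs Rs w" using assms by (simp add: pres_class_def pres_refl)
  then have "(SOME v. v \<in> pres_class Xs Rs w) \<in> pres_class Xs Rs w" by (rule someI)
  then have "pres_eq Rs (SOME v. v \<in> pres_class Xs Rs w) w" by (simp add: pres_class_def)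
  then show ?thesis
    unfolding pres_hom_def by (rule K.word_eval_pres_eq[OF _ f rels])
qed

lemma pres_hom_hom: "pres_hom K f \<in> hom (presented_group Xs Rs) K"
  by (rule homI)
    (auto simp: presented_group_carrier presented_group_mult pres_hom_class K.word_eval_append f)

end

text \<open>The uniqueness half of the universal property, by induction on the word. It allows two
  homomorphisms to be compared on generators alone.\<close>

lemma hom_pres_class:
  assumes "group K" "h \<in> hom (presented_group Xs Rs) K" "w \<in> words_on Xs"
  shows "h (pres_class Xs Rs w) = word_eval K (\<lambda>x. h (pres_class Xs Rs [(x, True)])) w"
proof -
  interpret H: group_hom "presented_group Xs Rs" K h
    using assms presented_group_is_group by (simp add: group_hom_def group_hom_axioms_def)
  show ?thesis using assms(3)
  proof (induction w)
    case Nil then show ?case using H.hom_one by (simp add: presented_group_one)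
  next
    case (Cons l w)
    obtain x b where l: "l = (x, b)" by force
    with Cons have x: "x \<in> Xs" and w: "w \<in> words_on Xs" by auto
    have "h (pres_class Xs Rs ([(x, b)] @ w)) = h (pres_class Xs Rs [(x, b)]) \<otimes>\<^bsub>K\<^esub> h (pres_class Xs Rs w)"
      using x w by (subst presented_group_mult[symmetric]) auto
    moreover have "h (pres_class Xs Rs [(x, False)]) = inv\<^bsub>K\<^esub> h (pres_class Xs Rs [(x, True)])"
      using x presented_group_inv[of "[(x, True)]" Xs Rs] H.hom_inv[of "pres_class Xs Rs [(x, True)]"]
      by (simp add: word_inv_def)
    ultimately show ?case using Cons l w by auto
  qed
qed

section \<open>Adjoining a cube root\<close>

text \<open>\<open>Syl t e r\<close> stands for \<open>t x r\<close> (\<open>e = False\<close>) or \<open>t x\<^sup>2 r\<close> (\<open>e = True\<close>), where \<open>x\<close> is the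
  adjoined cube root.\<close>

datatype 'a nform = Tail 'a | Syl 'a bool "'a nform"

primrec syllables :: "'a nform \<Rightarrow> nat" where
  "syllables (Tail h) = 0"
| "syllables (Syl t e r) = Suc (syllables r)"

text \<open>The element \<open>g\<close> is to become a cube, and \<open>C\<close> is the subgroup
  to be amalgamated. It may be finite or infinite; for trivial \<open>g\<close> the construction is
  the free product with a group of order three.\<close>

locale root_adjunction = group G for G (structure) +
  fixes g :: 'a
  assumes g_closed [simp]: "g \<in> carrier G"
begin

abbreviation C :: "'a set" where "C \<equiv> generate G {g}"

text \<open>Chosen representative of the left coset of \<open>C\<close>, normalised to be one on
  \<open>C\<close> itself, so that comparing a representative with one decides membership in
  \<open>C\<close>.\<close>

definition rep :: "'a \<Rightarrow> 'a" where
  "rep u = (if u \<in> C then \<one> else SOME y. y \<in> u <# C)"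

lemma C_subgroup: "subgroup C G"
  by (simp add: generate_is_subgroup)

lemma C_subset [simp]: "c \<in> C \<Longrightarrow> c \<in> carrier G"
  by (rule subgroup.mem_carrier[OF C_subgroup])

lemma g_in_C [simp]: "g \<in> C"
  by (simp add: generate.incl)

lemma C_mult [simp]: "a \<in> C \<Longrightarrow> b \<in> C \<Longrightarrow> a \<otimes> b \<in> C"
  by (rule subgroup.m_closed[OF C_subgroup])

lemma C_inv [simp]: "a \<in> C \<Longrightarrow> inv a \<in> C"
  by (rule subgroup.m_inv_closed[OF C_subgroup])

lemma C_one [simp]: "\<one> \<in> C"
  by (rule subgroup.one_closed[OF C_subgroup])

lemma C_mult_iff:
  assumes "c \<in> C" "u \<in> carrier G"
  shows "c \<otimes> u \<in> C \<longleftrightarrow> u \<in> C" "u \<otimes> c \<in> C \<longleftrightarrow> u \<in> C"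
proof -
  have "u = inv c \<otimes> (c \<otimes> u)" "u = (u \<otimes> c) \<otimes> inv c"
    using assms by (simp_all add: m_assoc[symmetric]) (simp add: m_assoc)
  then show "c \<otimes> u \<in> C \<longleftrightarrow> u \<in> C" "u \<otimes> c \<in> C \<longleftrightarrow> u \<in> C"
    using assms by (metis C_inv C_mult)+
qed

lemma rep_props:
  assumes "u \<in> carrier G"
  shows rep_closed: "rep u \<in> carrier G" and inv_rep_mult: "inv (rep u) \<otimes> u \<in> C"
    and rep_in_C_iff: "rep u \<in> C \<longleftrightarrow> u \<in> C"
proof -
  obtain c where c: "c \<in> C" "rep u = u \<otimes> c"
  proof (cases "u \<in> C")
    case True
    then show ?thesis using that[of "inv u"] assms by (simp add: rep_def)
  next
    case False
    have "u \<otimes> \<one> \<in> u <# C" unfolding l_coset_def using C_one by blast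
    then have "(SOME y. y \<in> u <# C) \<in> u <# C" by (rule someI)
    then have "rep u \<in> u <# C" using False by (simp add: rep_def)
    then show ?thesis using that unfolding l_coset_def by blast
  qed
  then show "rep u \<in> carrier G" "rep u \<in> C \<longleftrightarrow> u \<in> C" using assms by (simp_all add: C_mult_iff)
  show "inv (rep u) \<otimes> u \<in> C" using assms c by (simp add: inv_mult_group m_assoc)
qed

lemma rep_mult_C:
  assumes "u \<in> carrier G" "c \<in> C"
  shows "rep (u \<otimes> c) = rep u"
proof -
  have "u \<otimes> c \<in> u <# C" using assms(2) by (auto simp: l_coset_def)
  then have "u <# C = (u \<otimes> c) <# C"
    by (rule l_repr_independence[OF _ assms(1) C_subgroup])
  then show ?thesis unfolding rep_def C_mult_iff(2)[OF assms(2,1)] by simp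
qed

lemma rep_C: "c \<in> C \<Longrightarrow> rep c = \<one>"
  by (simp add: rep_def)

lemma rep_eq_one_iff: "u \<in> carrier G \<Longrightarrow> rep u = \<one> \<longleftrightarrow> u \<in> C"
  using rep_in_C_iff[of u] rep_C[of u] by auto

lemma rep_rep:
  assumes u: "u \<in> carrier G" shows "rep (rep u) = rep u"
proof -
  have "u \<otimes> inv (inv (rep u) \<otimes> u) = rep u"
    using u rep_closed[OF u] by (simp add: inv_mult_group m_assoc[symmetric])
  moreover have "rep (u \<otimes> inv (inv (rep u) \<otimes> u)) = rep u"
    using u by (intro rep_mult_C C_inv inv_rep_mult)
  ultimately show ?thesis by simp
qed

text \<open>Writing \<open>u t = t' c\<close> with \<open>t' = rep (u t)\<close> and \<open>c \<in> C\<close>, the factor \<open>c\<close> commutes with \<open>x\<close> and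
  is passed on to the rest of the normal form.\<close>

primrec act :: "'a \<Rightarrow> 'a nform \<Rightarrow> 'a nform" where
  act_Tail: "act u (Tail h) = Tail (u \<otimes> h)"
| act_Syl: "act u (Syl t e r) = Syl (rep (u \<otimes> t)) e (act (inv (rep (u \<otimes> t)) \<otimes> (u \<otimes> t)) r)"

text \<open>Condition on what may follow a power of \<open>x\<close>: a further syllable must start
  with a nontrivial representative, so that no two powers of \<open>x\<close> are adjacent.\<close>

primrec interior :: "'a nform \<Rightarrow> bool" where
  "interior (Tail h) = True"
| "interior (Syl t e r) = (t \<noteq> \<one>)"

primrec valid :: "'a nform \<Rightarrow> bool" where
  "valid (Tail h) = (h \<in> carrier G)"
| "valid (Syl t e r) = (t \<in> carrier G \<and> rep t = t \<and> interior r \<and> valid r)"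

text \<open>Left multiplication by \<open>x\<close>. The \<open>act g r\<close> branch is the
  wrap-around: \<open>x\<close> times \<open>x\<^sup>2 r\<close> equals \<open>g r\<close>.\<close>

primrec root_act :: "'a nform \<Rightarrow> 'a nform" where
  "root_act (Tail h) = Syl \<one> False (Tail h)"
| "root_act (Syl t e r) = (if t \<noteq> \<one> then Syl \<one> False (Syl t e r)
      else if e then act g r else Syl \<one> True r)"

text \<open>An element of \<open>C\<close> cannot move a coset other than \<open>C\<close> onto
  \<open>C\<close>, so it preserves interiority. Both claims go through one induction because the
  remainder of a form is acted on by an element of \<open>C\<close>.\<close>

lemma act_valid_interior:
  assumes "valid r" "u \<in> carrier G"
  shows "valid (act u r) \<and> (u \<in> C \<longrightarrow> interior r \<longrightarrow> interior (act u r))"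
  using assms
proof (induction r arbitrary: u)
  case (Tail h)
  then show ?case by simp
next
  case (Syl t e r)
  then have ut: "u \<otimes> t \<in> carrier G" by simp
  have "inv (rep (u \<otimes> t)) \<otimes> (u \<otimes> t) \<in> C" by (rule inv_rep_mult[OF ut])
  moreover have "rep (u \<otimes> t) \<noteq> \<one>" if "u \<in> C" "t \<noteq> \<one>"
    using that Syl.prems rep_eq_one_iff[OF ut] rep_eq_one_iff[of t] C_mult_iff(1)[of u t] by auto
  ultimately show ?case
    using Syl.IH[of "inv (rep (u \<otimes> t)) \<otimes> (u \<otimes> t)"] Syl.prems ut
    by (simp add: rep_closed rep_rep)
qed

lemma act_valid: "valid r \<Longrightarrow> u \<in> carrier G \<Longrightarrow> valid (act u r)"
  using act_valid_interior by blast

lemma act_interior: "valid r \<Longrightarrow> u \<in> C \<Longrightarrow> interior r \<Longrightarrow> interior (act u r)"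
  using act_valid_interior[of r u] by simp

lemma act_one: "valid r \<Longrightarrow> act \<one> r = r"
  by (induction r) auto

text \<open>If \<open>v t = s c\<close> and \<open>u s = s' d\<close> with \<open>c\<close>,
  \<open>d\<close> in \<open>C\<close> and \<open>s' = rep (u \<otimes> s)\<close>, then
  \<open>u v t = s' d c\<close>. So the representative is the expected one and the factors passed on
  multiply, which is what the induction needs.\<close>

lemma act_mult:
  assumes "valid r" "u \<in> carrier G" "v \<in> carrier G"
  shows "act (u \<otimes> v) r = act u (act v r)"
  using assms
proof (induction r arbitrary: u v)
  case (Tail h)
  then show ?case by (simp add: m_assoc)
next
  case (Syl t e r)
  define s where "s = rep (v \<otimes> t)"
  define c where "c = inv s \<otimes> (v \<otimes> t)"
  define d where "d = inv (rep (u \<otimes> s)) \<otimes> (u \<otimes> s)"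
  have vt: "v \<otimes> t \<in> carrier G" using Syl.prems by simp
  have s: "s \<in> carrier G" unfolding s_def by (rule rep_closed[OF vt])
  have c: "c \<in> C" unfolding c_def s_def by (rule inv_rep_mult[OF vt])
  have us: "u \<otimes> s \<in> carrier G" using s Syl.prems by simp
  have d: "d \<in> C" unfolding d_def by (rule inv_rep_mult[OF us])
  have "v \<otimes> t = s \<otimes> c"
    unfolding c_def using s vt by (simp add: m_assoc[symmetric] del: m_closed)
  then have uvt: "u \<otimes> v \<otimes> t = u \<otimes> s \<otimes> c"
    using Syl.prems s C_subset[OF c] by (simp add: m_assoc)
  have rep: "rep (u \<otimes> v \<otimes> t) = rep (u \<otimes> s)"
    unfolding uvt by (rule rep_mult_C[OF us c])
  have "inv (rep (u \<otimes> s)) \<otimes> (u \<otimes> s \<otimes> c) = d \<otimes> c"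
    unfolding d_def using us rep_closed[OF us] C_subset[OF c] by (simp only: m_assoc[OF inv_closed])
  then have "act (u \<otimes> v) (Syl t e r) = Syl (rep (u \<otimes> s)) e (act (d \<otimes> c) r)"
    by (simp only: act_Syl rep) (simp only: uvt)
  also have "act (d \<otimes> c) r = act d (act c r)"
    using Syl c d by simp
  finally show ?case by (simp only: act_Syl s_def[symmetric] c_def[symmetric] d_def[symmetric])
qed

lemma root_act_interior: "interior r \<Longrightarrow> root_act r = Syl \<one> False r"
  by (cases r) auto

lemma root_act_valid: "valid r \<Longrightarrow> valid (root_act r)"
  by (cases r) (auto simp: rep_C act_valid)

text \<open>On an interior form the three applications build \<open>x\<close>, then
  \<open>x\<^sup>2\<close>, then wrap around. Otherwise the form starts with a power of
  \<open>x\<close> and wraps around earlier; the remainder stays interior under \<open>g\<close>, so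
  the other applications just prepend powers again.\<close>

lemma root_act_cube:
  assumes "valid r" shows "root_act (root_act (root_act r)) = act g r"
proof (cases "interior r")
  case True
  then show ?thesis by (simp add: root_act_interior)
next
  case False
  then obtain e r' where r: "r = Syl \<one> e r'" by (cases r) auto
  with assms have "interior (act g r')" by (simp add: act_interior)
  then show ?thesis using r by (cases e) (simp_all add: root_act_interior rep_C)
qed

section \<open>Permutations of the normal forms\<close>

abbreviation NF_sym :: "('a nform \<Rightarrow> 'a nform) monoid" where
  "NF_sym \<equiv> BijGroup {r. valid r}"

lemma NF_sym_mult:
  "a \<in> carrier NF_sym \<Longrightarrow> b \<in> carrier NF_sym \<Longrightarrow> valid r \<Longrightarrow> (a \<otimes>\<^bsub>NF_sym\<^esub> b) r = a (b r)"
  by (simp add: BijGroup_def compose_def)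

lemma NF_sym_eqI:
  assumes "a \<in> carrier NF_sym" "b \<in> carrier NF_sym" "\<And>r. valid r \<Longrightarrow> a r = b r"
  shows "a = b"
  using assms by (intro extensionalityI[of _ "{r. valid r}"]) (auto simp: BijGroup_def Bij_def)

definition act_perm :: "'a \<Rightarrow> 'a nform \<Rightarrow> 'a nform" where
  "act_perm u = restrict (act u) {r. valid r}"

definition root_perm :: "'a nform \<Rightarrow> 'a nform" where
  "root_perm = restrict root_act {r. valid r}"

lemma act_inv:
  assumes "valid r" "u \<in> carrier G"
  shows "act (inv u) (act u r) = r" "act u (act (inv u) r) = r"
  using assms act_mult[of r "inv u" u] act_mult[of r u "inv u"] by (simp_all add: act_one)

lemma act_perm_closed: "u \<in> carrier G \<Longrightarrow> act_perm u \<in> carrier NF_sym"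
  unfolding act_perm_def BijGroup_def Bij_def
  by (auto intro!: bij_betw_byWitness[where f' = "act (inv u)"] simp: act_inv act_valid)

text \<open>Bijectivity is inherited from the cube, which is the bijection \<open>act g\<close>: a
  map is injective if its cube is, and a preimage of \<open>s\<close> is obtained by applying
  \<open>root_act\<close> twice to \<open>act (inv g) s\<close>.\<close>

lemma root_perm_closed: "root_perm \<in> carrier NF_sym"
proof -
  have "inj_on root_act {r. valid r}"
  proof (rule inj_onI)
    fix r s assume rs: "r \<in> {r. valid r}" "s \<in> {r. valid r}" "root_act r = root_act s"
    then have "act g r = act g s" using root_act_cube[of r] root_act_cube[of s] by simp
    then have "act (inv g) (act g r) = act (inv g) (act g s)" by (rule arg_cong)
    then show "r = s" using rs(1,2) by (simp add: act_inv(1))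
  qed
  moreover have "s \<in> root_act ` {r. valid r}" if "valid s" for s
  proof
    show "s = root_act (root_act (root_act (act (inv g) s)))"
      using that by (simp add: root_act_cube act_valid act_inv)
    show "root_act (root_act (act (inv g) s)) \<in> {r. valid r}"
      using that by (simp add: root_act_valid act_valid)
  qed
  ultimately show ?thesis
    unfolding root_perm_def BijGroup_def Bij_def by (auto simp: bij_betw_def root_act_valid)
qed

lemma act_perm_hom: "act_perm \<in> hom G NF_sym"
proof (rule homI)
  fix u v assume uv: "u \<in> carrier G" "v \<in> carrier G"
  show "act_perm (u \<otimes> v) = act_perm u \<otimes>\<^bsub>NF_sym\<^esub> act_perm v"
  proof (rule NF_sym_eqI)
    show "act_perm u \<otimes>\<^bsub>NF_sym\<^esub> act_perm v \<in> carrier NF_sym"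
      by (intro monoid.m_closed group.is_monoid group_BijGroup act_perm_closed uv)
  qed (use uv in \<open>simp_all add: act_perm_closed NF_sym_mult act_mult act_valid, simp_all add: act_perm_def act_mult act_valid\<close>)
qed (rule act_perm_closed)

lemma root_perm_cube: "root_perm \<otimes>\<^bsub>NF_sym\<^esub> root_perm \<otimes>\<^bsub>NF_sym\<^esub> root_perm = act_perm g"
proof -
  interpret S: group NF_sym by (rule group_BijGroup)
  show ?thesis
  proof (rule NF_sym_eqI)
    fix r assume r: "valid r"
    then have "valid (root_perm r)" by (simp add: root_perm_def root_act_valid)
    with r show "(root_perm \<otimes>\<^bsub>NF_sym\<^esub> root_perm \<otimes>\<^bsub>NF_sym\<^esub> root_perm) r = act_perm g r"
      by (simp add: NF_sym_mult root_perm_closed)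
        (simp add: root_perm_def act_perm_def root_act_valid root_act_cube)
  qed (simp_all add: root_perm_closed act_perm_closed)
qed

end

section \<open>Torsion in a group with an adjoined cube root\<close>

lemma (in group) finite_order_conj:
  assumes "finite_order G y" "y \<in> carrier G" "b \<in> carrier G"
  shows "finite_order G (b \<otimes> y \<otimes> inv b)"
proof -
  have "(b \<otimes> y \<otimes> inv b) [^] k = b \<otimes> y [^] k \<otimes> inv b" for k :: nat
  proof (induction k)
    case (Suc k)
    have "inv b \<otimes> (b \<otimes> z) = z" if "z \<in> carrier G" for z
      using assms that by (simp add: m_assoc[symmetric])
    with Suc show ?case using assms by (simp add: m_assoc)
  qed (use assms in simp)
  then show ?thesis using assms unfolding finite_order_def by force
qed

text \<open>The products \<open>a \<otimes> b\<close> and \<open>b \<otimes> a\<close> are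
  conjugate, and finite order and membership in \<open>N\<close> are both invariant under
  conjugation. This permits cyclic rotation of words below.\<close>

lemma (in group) finite_order_in_normal_rotate:
  assumes "N \<lhd> G" "finite_order G (a \<otimes> b) \<Longrightarrow> a \<otimes> b \<in> N" "a \<in> carrier G" "b \<in> carrier G"
    "finite_order G (b \<otimes> a)"
  shows "b \<otimes> a \<in> N"
proof -
  have 1: "a \<otimes> (b \<otimes> a) \<otimes> inv a = a \<otimes> b" "b \<otimes> (a \<otimes> b) \<otimes> inv b = b \<otimes> a"
    using assms by (simp_all add: m_assoc)
  have "finite_order G (a \<otimes> b)"
    using finite_order_conj[of "b \<otimes> a" a] assms 1 by simp
  then have "b \<otimes> (a \<otimes> b) \<otimes> inv b \<in> N"
    using assms by (intro normal.inv_op_closed2) auto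
  then show ?thesis by (simp add: 1)
qed

text \<open>Instead of a universal property, \<open>H\<close> is required to act on the normal
  forms, with \<open>G\<close> acting by \<open>act_perm\<close> and \<open>x\<close> by
  \<open>root_perm\<close>. Generation is an induction rule without inverses of \<open>x\<close>,
  since the inverse of \<open>x\<close> is \<open>x\<^sup>2\<close> times the image of the inverse
  of \<open>g\<close>.\<close>

locale root_extension = root_adjunction G g + H: group H
  for G (structure) and g and H (structure) +
  fixes \<iota> :: "'a \<Rightarrow> 'c" and x :: 'c and \<rho> :: "'c \<Rightarrow> 'a nform \<Rightarrow> 'a nform"
  assumes iota_hom: "\<iota> \<in> hom G H"
    and x_closed [simp]: "x \<in> carrier H"
    and x_cube: "x \<otimes>\<^bsub>H\<^esub> x \<otimes>\<^bsub>H\<^esub> x = \<iota> g"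
    and rho_hom: "\<rho> \<in> hom H NF_sym"
    and rho_iota: "u \<in> carrier G \<Longrightarrow> \<rho> (\<iota> u) = act_perm u"
    and rho_x: "\<rho> x = root_perm"
    and generated [consumes 1, case_names one iota x]:
      "y \<in> carrier H \<Longrightarrow> P \<one>\<^bsub>H\<^esub> \<Longrightarrow> (\<And>u y. u \<in> carrier G \<Longrightarrow> y \<in> carrier H \<Longrightarrow> P y \<Longrightarrow> P (\<iota> u \<otimes>\<^bsub>H\<^esub> y))
        \<Longrightarrow> (\<And>y. y \<in> carrier H \<Longrightarrow> P y \<Longrightarrow> P (x \<otimes>\<^bsub>H\<^esub> y)) \<Longrightarrow> P y"
begin

sublocale I: group_hom G H \<iota>
  by unfold_locales (rule iota_hom)

lemma rho_mult:
  "a \<in> carrier H \<Longrightarrow> b \<in> carrier H \<Longrightarrow> valid r \<Longrightarrow> \<rho> (a \<otimes>\<^bsub>H\<^esub> b) r = \<rho> a (\<rho> b r)"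
  using rho_hom NF_sym_mult[of "\<rho> a" "\<rho> b" r] by (auto simp: hom_def)

lemma rho_iota_apply: "u \<in> carrier G \<Longrightarrow> valid r \<Longrightarrow> \<rho> (\<iota> u) r = act u r"
  by (simp add: rho_iota act_perm_def)

lemma rho_x_apply: "valid r \<Longrightarrow> \<rho> x r = root_act r"
  by (simp add: rho_x root_perm_def)

lemma rho_one: "valid r \<Longrightarrow> \<rho> \<one>\<^bsub>H\<^esub> r = r"
  using rho_iota_apply[of \<one> r] by (simp add: act_one)

text \<open>The action recovers \<open>u\<close>: it sends the trivial tail to
  \<open>Tail u\<close>.\<close>

lemma iota_inj:
  assumes "u \<in> carrier G" "\<iota> u = \<one>\<^bsub>H\<^esub>" shows "u = \<one>"
  using assms rho_iota_apply[of u "Tail \<one>"] rho_one[of "Tail \<one>"] by simp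

lemma finite_order_iota:
  assumes "u \<in> carrier G" "finite_order H (\<iota> u)" shows "finite_order G u"
  using assms unfolding finite_order_def by (metis I.hom_nat_pow iota_inj nat_pow_closed)

lemma iota_C_power:
  assumes "c \<in> C" shows "\<exists>k::int. \<iota> c = x [^]\<^bsub>H\<^esub> k"
proof -
  obtain j :: int where "c = g [^] j" using assms generate_pow[OF g_closed] by auto
  then have "\<iota> c = (\<iota> g) [^]\<^bsub>H\<^esub> j" by (simp add: I.hom_int_pow)
  also have "\<iota> g = x [^]\<^bsub>H\<^esub> (3::int)"
    by (simp add: x_cube[symmetric] H.m_assoc int_pow_def2 numeral_3_eq_3)
  finally show ?thesis by (auto simp: H.int_pow_pow)
qed

lemma iota_C_commute:
  assumes "c \<in> C" shows "\<iota> c \<otimes>\<^bsub>H\<^esub> x = x \<otimes>\<^bsub>H\<^esub> \<iota> c"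
proof -
  obtain k :: int where k: "\<iota> c = x [^]\<^bsub>H\<^esub> k" using iota_C_power[OF assms] by blast
  have "x [^]\<^bsub>H\<^esub> k \<otimes>\<^bsub>H\<^esub> x [^]\<^bsub>H\<^esub> (1::int) = x [^]\<^bsub>H\<^esub> (1::int) \<otimes>\<^bsub>H\<^esub> x [^]\<^bsub>H\<^esub> k"
    by (simp only: H.int_pow_mult[OF x_closed, symmetric] add.commute)
  then show ?thesis by (simp add: k H.int_pow_1)
qed

lemma iota_C_left_commute:
  assumes "c \<in> C" "z \<in> carrier H"
  shows "\<iota> c \<otimes>\<^bsub>H\<^esub> (x \<otimes>\<^bsub>H\<^esub> z) = x \<otimes>\<^bsub>H\<^esub> (\<iota> c \<otimes>\<^bsub>H\<^esub> z)"
  using assms iota_C_commute[OF assms(1)] by (simp add: H.m_assoc[symmetric])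

definition xpow :: "bool \<Rightarrow> 'c" where
  "xpow e = (if e then x \<otimes>\<^bsub>H\<^esub> x else x)"

lemma xpow_closed [simp]: "xpow e \<in> carrier H"
  by (simp add: xpow_def)

lemma xpow_int_pow: "xpow e = x [^]\<^bsub>H\<^esub> (if e then 2 else 1 :: int)"
proof (cases e)
  case True
  have "x [^]\<^bsub>H\<^esub> (1 + 1 :: int) = x \<otimes>\<^bsub>H\<^esub> x" by (simp only: H.int_pow_mult x_closed H.int_pow_1)
  with True show ?thesis by (simp add: xpow_def)
qed (simp add: xpow_def)

text \<open>The coefficients are arbitrary elements of \<open>G\<close> rather than coset
  representatives; the torsion argument only asks which of them lie in \<open>C\<close>.\<close>

fun sylprod :: "(bool \<times> 'a) list \<Rightarrow> 'c" where
  "sylprod [] = \<one>\<^bsub>H\<^esub>"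
| "sylprod ((e, u) # l) = xpow e \<otimes>\<^bsub>H\<^esub> (\<iota> u \<otimes>\<^bsub>H\<^esub> sylprod l)"

abbreviation syls :: "(bool \<times> 'a) list \<Rightarrow> bool" where
  "syls l \<equiv> snd ` set l \<subseteq> carrier G"

lemma sylprod_closed [simp]: "syls l \<Longrightarrow> sylprod l \<in> carrier H"
  by (induction l rule: sylprod.induct) auto

lemma sylprod_append:
  "syls l \<Longrightarrow> syls l' \<Longrightarrow> sylprod (l @ l') = sylprod l \<otimes>\<^bsub>H\<^esub> sylprod l'"
  by (induction l rule: sylprod.induct) (auto simp: H.m_assoc)

lemma sylprod_power:
  assumes "syls l" shows "sylprod (concat (replicate m l)) = sylprod l [^]\<^bsub>H\<^esub> m"
proof (induction m)
  case (Suc m)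
  have "syls (concat (replicate m l))" using assms by fastforce
  then have "sylprod (concat (replicate (Suc m) l)) = sylprod l \<otimes>\<^bsub>H\<^esub> sylprod l [^]\<^bsub>H\<^esub> m"
    using Suc assms by (simp add: sylprod_append)
  then show ?case using assms by (simp only: H.nat_pow_Suc2[OF sylprod_closed])
qed simp

lemma syllables_act [simp]: "syllables (act u r) = syllables r"
  by (induction r arbitrary: u) auto

text \<open>Consequently a nonempty reduced product is nontrivial.\<close>

lemma reduced_action:
  assumes "syls l" "snd ` set l \<inter> C = {}"
  shows "valid (\<rho> (sylprod l) (Tail \<one>)) \<and> syllables (\<rho> (sylprod l) (Tail \<one>)) = length l
    \<and> (\<rho> (sylprod l) (Tail \<one>) = Tail \<one> \<or> \<not> interior (\<rho> (sylprod l) (Tail \<one>)))"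
  using assms
proof (induction l rule: sylprod.induct)
  case 1
  then show ?case by (simp add: rho_one)
next
  case (2 e u l)
  define r where "r = \<rho> (sylprod l) (Tail \<one>)"
  have u: "u \<in> carrier G" "u \<notin> C" and l: "syls l" using 2 by auto
  have r: "valid r" "syllables r = length l" "r = Tail \<one> \<or> \<not> interior r"
    using 2 by (auto simp: r_def)
  have "valid (Tail \<one>)" by simp
  then have "\<rho> (\<iota> u \<otimes>\<^bsub>H\<^esub> sylprod l) (Tail \<one>) = act u r"
    using u l r(1) by (simp add: rho_mult rho_iota_apply r_def del: valid.simps)
  then have eq: "\<rho> (sylprod ((e, u) # l)) (Tail \<one>) = \<rho> (xpow e) (act u r)"
    using u l by (simp add: rho_mult)
  \<comment> \<open>Either \<open>r\<close> is the trivial tail, or its first coefficient is one and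
    becomes \<open>rep u\<close>, which is not one because \<open>u\<close> lies outside
    \<open>C\<close>. Hence the power of \<open>x\<close> is prepended without any
    cancellation.\<close>
  have "interior (act u r)"
    using r u by (cases r) (auto simp: rep_eq_one_iff)
  moreover have "valid (act u r)" using r u by (simp add: act_valid)
  ultimately have "\<rho> (xpow e) (act u r) = Syl \<one> e (act u r)"
    by (cases e) (simp_all add: xpow_def rho_mult rho_x_apply root_act_interior root_act_valid rep_C)
  with eq \<open>interior (act u r)\<close> \<open>valid (act u r)\<close> r show ?case by (simp add: rep_C)
qed

context
  fixes N
  assumes N: "N \<lhd> H"
    and N_iota: "\<And>u. u \<in> carrier G \<Longrightarrow> finite_order G u \<Longrightarrow> \<iota> u \<in> N"
    and N_x: "\<And>k::int. finite_order H (x [^]\<^bsub>H\<^esub> k) \<Longrightarrow> x [^]\<^bsub>H\<^esub> k \<in> N"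
begin

text \<open>Rotating \<open>\<iota> v\<close> to the end merges it into the last coefficient, so a
  leading factor from \<open>G\<close> costs no syllable. With no syllables left, injectivity of
  \<open>\<iota>\<close> makes \<open>v\<close> itself torsion in \<open>G\<close>.\<close>

lemma torsion_iota_sylprod:
  assumes IH: "\<And>l'. length l' = length l \<Longrightarrow> syls l' \<Longrightarrow> finite_order H (sylprod l') \<Longrightarrow> sylprod l' \<in> N"
    and l: "syls l" and v: "v \<in> carrier G" and fin: "finite_order H (\<iota> v \<otimes>\<^bsub>H\<^esub> sylprod l)"
  shows "\<iota> v \<otimes>\<^bsub>H\<^esub> sylprod l \<in> N"
proof (cases l rule: rev_cases)
  case Nil
  then show ?thesis using v fin N_iota[of v] finite_order_iota[of v] by simp
next
  case (snoc l0 a)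
  obtain e u where a: "a = (e, u)" by force
  have l0: "syls l0" "u \<in> carrier G" using l snoc a by auto
  have "sylprod l \<otimes>\<^bsub>H\<^esub> \<iota> v = sylprod (l0 @ [(e, u \<otimes> v)])"
    using l0 v by (simp add: snoc a sylprod_append H.m_assoc)
  moreover have "syls (l0 @ [(e, u \<otimes> v)])" using l0 v by auto
  ultimately have "finite_order H (sylprod l \<otimes>\<^bsub>H\<^esub> \<iota> v) \<Longrightarrow> sylprod l \<otimes>\<^bsub>H\<^esub> \<iota> v \<in> N"
    using IH[of "l0 @ [(e, u \<otimes> v)]"] snoc by simp
  then show ?thesis
    using H.finite_order_in_normal_rotate[OF N] fin l v by simp
qed

text \<open>Strong induction on the number of syllables. If no coefficient lies in \<open>C\<close>,
  all powers are reduced, which excludes torsion unless the list is empty. A coefficient in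
  \<open>C\<close> commutes with \<open>x\<close>; once it is rotated into the first syllable, the
  two neighbouring powers of \<open>x\<close> merge and the product gets shorter, or a single power
  of \<open>x\<close> remains.\<close>

lemma torsion_sylprod:
  "syls l \<Longrightarrow> finite_order H (sylprod l) \<Longrightarrow> sylprod l \<in> N"
proof (induction "length l" arbitrary: l rule: less_induct)
  case less
  consider "l = []" | "l \<noteq> []" "snd ` set l \<inter> C = {}" | "\<exists>a\<in>set l. snd a \<in> C" by auto
  then show ?case
  proof cases
    case 1
    then show ?thesis using N by (simp add: normal_imp_subgroup subgroup.one_closed)
  next
    case 2
    obtain m :: nat where m: "m > 0" "sylprod l [^]\<^bsub>H\<^esub> m = \<one>\<^bsub>H\<^esub>"
      using less.prems unfolding finite_order_def by blast
    let ?l = "concat (replicate m l)"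
    \<comment> \<open>Repeating the list keeps it reduced, so it takes the trivial tail to a form
      with \<open>m * length l\<close> syllables; but the power is trivial and produces
      none.\<close>
    have "set ?l = set l" using m by auto
    then have "syllables (\<rho> (sylprod ?l) (Tail \<one>)) = length ?l"
      using reduced_action[of ?l] 2 less.prems by simp
    then have "length ?l = 0"
      using less.prems m by (simp only: sylprod_power) (simp add: rho_one)
    then show ?thesis using m 2 by simp
  next
    case 3
    then obtain l1 a l2 where split: "l = l1 @ a # l2" "snd a \<in> C" by (metis split_list)
    obtain e c where a: "a = (e, c)" by force
    have c: "c \<in> C" "c \<in> carrier G" using split a by auto
    have l12: "syls l1" "syls l2" using less.prems split by auto
    have "finite_order H (sylprod (a # l2 @ l1)) \<Longrightarrow> sylprod (a # l2 @ l1) \<in> N"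
    proof (cases "l2 @ l1")
      case Nil
      obtain k :: int where "\<iota> c = x [^]\<^bsub>H\<^esub> k" using iota_C_power c by blast
      then have "sylprod (a # l2 @ l1) = x [^]\<^bsub>H\<^esub> ((if e then 2 else 1) + k)"
        unfolding Nil a by (simp add: xpow_int_pow H.int_pow_mult)
      then show "finite_order H (sylprod (a # l2 @ l1)) \<Longrightarrow> ?thesis" using N_x by simp
    next
      case (Cons b l3)
      obtain e' u where b: "b = (e', u)" by force
      have "syls (l2 @ l1)" using l12 by auto
      then have u: "u \<in> carrier G" "syls l3" using Cons b by auto
      note simps = xpow_def c u H.m_assoc iota_C_left_commute x_cube[symmetric]
      have len: "length l = Suc (Suc (length l3))"
        using arg_cong[OF Cons, of length] split by simp
      assume fin: "finite_order H (sylprod (a # l2 @ l1))"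
      have eq: "sylprod (a # l2 @ l1) = xpow e \<otimes>\<^bsub>H\<^esub> (\<iota> c \<otimes>\<^bsub>H\<^esub> (xpow e' \<otimes>\<^bsub>H\<^esub> (\<iota> u \<otimes>\<^bsub>H\<^esub> sylprod l3)))"
        by (simp add: a b Cons)
      \<comment> \<open>The exponents add up to 2, 4 or 3. Exponent 4 leaves one \<open>x\<close>
        and a factor \<open>g\<close>; exponent 3 leaves only \<open>g\<close>, so the syllable
        disappears and the product starts with an element of \<open>G\<close>.\<close>
      consider "\<not> e" "\<not> e'" | "e" "e'" | "e \<noteq> e'" by auto
      then show ?thesis
      proof cases
        case 1
        then have "sylprod (a # l2 @ l1) = sylprod ((True, c \<otimes> u) # l3)"
          unfolding eq by (simp add: simps)
        then show ?thesis using less.hyps[of "(True, c \<otimes> u) # l3"] fin len u c by simp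
      next
        case 2
        then have "sylprod (a # l2 @ l1) = sylprod ((False, g \<otimes> (c \<otimes> u)) # l3)"
          unfolding eq by (simp add: simps)
        then show ?thesis using less.hyps[of "(False, g \<otimes> (c \<otimes> u)) # l3"] fin len u c by simp
      next
        case 3
        then have "sylprod (a # l2 @ l1) = \<iota> (g \<otimes> (c \<otimes> u)) \<otimes>\<^bsub>H\<^esub> sylprod l3"
          unfolding eq by (auto simp add: simps)
        then show ?thesis using torsion_iota_sylprod[of l3 "g \<otimes> (c \<otimes> u)"] less.hyps fin len u c by simp
      qed
    qed
    moreover have "sylprod (a # l2 @ l1) = sylprod (a # l2) \<otimes>\<^bsub>H\<^esub> sylprod l1"
      using sylprod_append[of "a # l2" l1] l12 c a by simp
    moreover have "sylprod l = sylprod l1 \<otimes>\<^bsub>H\<^esub> sylprod (a # l2)"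
      using sylprod_append[of l1 "a # l2"] l12 c a split by simp
    moreover have "sylprod (a # l2) \<in> carrier H" using l12 c a by simp
    ultimately show ?thesis
      using H.finite_order_in_normal_rotate[OF N, of "sylprod (a # l2)" "sylprod l1"] less.prems l12 by simp
  qed
qed

theorem torsion_in_normal:
  assumes "y \<in> carrier H" "finite_order H y" shows "y \<in> N"
proof -
  have "\<exists>v l. v \<in> carrier G \<and> syls l \<and> y = \<iota> v \<otimes>\<^bsub>H\<^esub> sylprod l"
    using assms(1)
  proof (induction rule: generated)
    case one
    show ?case by (rule exI[of _ \<one>], rule exI[of _ "[]"]) simp
  next
    case (iota u y)
    then obtain v l where "v \<in> carrier G" "syls l" "y = \<iota> v \<otimes>\<^bsub>H\<^esub> sylprod l" by blast
    with iota show ?case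
      by (intro exI[of _ "u \<otimes> v"] exI[of _ l]) (simp add: H.m_assoc)
  next
    case (x y)
    then obtain v l where "v \<in> carrier G" "syls l" "y = \<iota> v \<otimes>\<^bsub>H\<^esub> sylprod l" by blast
    with x show ?case
      by (intro exI[of _ \<one>] exI[of _ "(False, v) # l"]) (simp add: xpow_def)
  qed
  then show ?thesis using torsion_iota_sylprod torsion_sylprod assms(2) by blast
qed

end

end

section \<open>Enlarging a presentation by a generator and a cube relator\<close>

lemma words_on_mono: "Xs \<subseteq> Ys \<Longrightarrow> w \<in> words_on Xs \<Longrightarrow> w \<in> words_on Ys"
  by (auto simp: in_lists_conv_set)

lemma pres_eq_mono: "pres_eq Rs u v \<Longrightarrow> Rs \<subseteq> Ss \<Longrightarrow> pres_eq Ss u v"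
  by (induction rule: pres_eq.induct) (auto intro: pres_eq.intros simp del: append.simps append_assoc)

text \<open>The homomorphism induced by adding generators and relators. Injectivity is not built in;
  for a cube root it comes from the action on normal forms.\<close>

definition pres_incl :: "'a set \<Rightarrow> 'a word set \<Rightarrow> 'a word set \<Rightarrow> 'a word set" where
  "pres_incl Ys Ss A = pres_class Ys Ss (SOME w. w \<in> A)"

lemma pres_incl_class:
  assumes "Xs \<subseteq> Ys" "Rs \<subseteq> Ss" "w \<in> words_on Xs"
  shows "pres_incl Ys Ss (pres_class Xs Rs w) = pres_class Ys Ss w"
proof -
  have "w \<in> pres_class Xs Rs w" using assms by (simp add: pres_class_def pres_refl)
  then have some: "(SOME v. v \<in> pres_class Xs Rs w) \<in> pres_class Xs Rs w" by (rule someI)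
  let ?v = "SOME v. v \<in> pres_class Xs Rs w"
  have "?v \<in> words_on Xs" "pres_eq Rs ?v w" using some by (simp_all add: pres_class_def)
  then have "?v \<in> words_on Ys" "pres_eq Ss ?v w"
    using words_on_mono[OF assms(1)] pres_eq_mono[OF _ assms(2)] by blast+
  then show ?thesis by (simp add: pres_incl_def pres_class_eq_iff)
qed

lemma pres_incl_hom:
  assumes "Xs \<subseteq> Ys" "Rs \<subseteq> Ss"
  shows "pres_incl Ys Ss \<in> hom (presented_group Xs Rs) (presented_group Ys Ss)"
proof (rule homI)
  note incl = pres_incl_class[OF assms] and mono = words_on_mono[OF assms(1)]
  fix A assume "A \<in> carrier (presented_group Xs Rs)"
  then obtain u where u: "u \<in> words_on Xs" "A = pres_class Xs Rs u" by (rule presented_groupE)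
  show "pres_incl Ys Ss A \<in> carrier (presented_group Ys Ss)"
    using u(1) mono[OF u(1)] unfolding u(2) by (simp add: incl)
  fix B assume "B \<in> carrier (presented_group Xs Rs)"
  then obtain v where v: "v \<in> words_on Xs" "B = pres_class Xs Rs v" by (rule presented_groupE)
  show "pres_incl Ys Ss (A \<otimes>\<^bsub>presented_group Xs Rs\<^esub> B)
      = pres_incl Ys Ss A \<otimes>\<^bsub>presented_group Ys Ss\<^esub> pres_incl Ys Ss B"
    using u(1) v(1) mono[OF u(1)] mono[OF v(1)] unfolding u(2) v(2)
    by (simp add: incl presented_group_mult)
qed

lemma pres_class_eq_word_eval:
  assumes "w \<in> words_on Xs" "\<And>y. y \<in> Xs \<Longrightarrow> f y = pres_class Xs Rs [(y, True)]"
  shows "word_eval (presented_group Xs Rs) f w = pres_class Xs Rs w"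
proof -
  interpret group "presented_group Xs Rs" by (rule presented_group_is_group)
  have "(\<lambda>A. A) \<in> hom (presented_group Xs Rs) (presented_group Xs Rs)"
    by (simp add: hom_def)
  from hom_pres_class[OF presented_group_is_group this assms(1)]
  show ?thesis using word_eval_cong[OF assms] by simp
qed

lemma pres_class_relator: "r \<in> Rs \<Longrightarrow> r \<in> words_on Xs \<Longrightarrow> pres_class Xs Rs r = \<one>\<^bsub>presented_group Xs Rs\<^esub>"
  by (simp add: presented_group_one pres_class_eq_iff pres_eq_relator)

text \<open>A single shape of relator serves all vertices of the tree: positive letters after an
  empty \<open>v\<close> for a leaf, inverse letters after the product of the two children for an
  inner vertex.\<close>

lemma (in group) word_eval_cube_relator_iff:
  assumes f: "range f \<subseteq> carrier G"
  shows "word_eval G f (v @ replicate 3 (x, b)) = \<one> \<longleftrightarrow>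
    f x \<otimes> f x \<otimes> f x = (if b then inv (word_eval G f v) else word_eval G f v)"
proof -
  let ?V = "word_eval G f v" and ?X = "f x \<otimes> f x \<otimes> f x"
  have fx: "f x \<in> carrier G" using f by auto
  have V: "?V \<in> carrier G" using f by simp
  have "word_eval G f (replicate 3 (x, b)) = (if b then ?X else inv ?X)"
    using fx by (simp add: numeral_3_eq_3 m_assoc inv_mult_group)
  then have eq: "word_eval G f (v @ replicate 3 (x, b)) = ?V \<otimes> (if b then ?X else inv ?X)"
    using f by (simp add: word_eval_append)
  show ?thesis
  proof (cases b)
    case True
    have "?V \<otimes> ?X = \<one> \<longleftrightarrow> ?X = inv ?V"
      using fx V inv_equality[of ?X ?V] inv_comm[of ?V ?X] r_inv[of ?V] by (metis m_closed)
    then show ?thesis using eq True by simp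
  next
    case False
    have "?V \<otimes> inv ?X = \<one> \<longleftrightarrow> ?X = ?V"
      using fx V inv_equality[of ?V "inv ?X"] r_inv[of ?X] by (metis m_closed inv_closed inv_inv)
    then show ?thesis using eq False by simp
  qed
qed

text \<open>The presentation of \<open>H\<close> is shown to be an instance of
  \<open>root_extension\<close>: von Dyck's theorem supplies the action on normal forms, and words
  in the generators supply the induction rule.\<close>

theorem torsion_adjoin_cube_root:
  fixes Xs :: "'a set" and Rs :: "'a word set" and x :: 'a and v :: "'a word" and b :: bool
  defines "H \<equiv> presented_group (insert x Xs) (insert (v @ replicate 3 (x, b)) Rs)"
    and "cl \<equiv> pres_class (insert x Xs) (insert (v @ replicate 3 (x, b)) Rs)"
  assumes x: "x \<notin> Xs" and Rs: "Rs \<subseteq> words_on Xs" and v: "v \<in> words_on Xs"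
    and N: "N \<lhd> H"
    and N_Xs: "\<And>w. w \<in> words_on Xs \<Longrightarrow> finite_order (presented_group Xs Rs) (pres_class Xs Rs w) \<Longrightarrow> cl w \<in> N"
    and N_x: "\<And>k::int. finite_order H (cl [(x, True)] [^]\<^bsub>H\<^esub> k) \<Longrightarrow> cl [(x, True)] [^]\<^bsub>H\<^esub> k \<in> N"
    and y: "y \<in> carrier H" "finite_order H y"
  shows "y \<in> N"
proof -
  let ?G = "presented_group Xs Rs" and ?Ss = "insert (v @ replicate 3 (x, b)) Rs"
  define \<iota> where "\<iota> = pres_incl (insert x Xs) ?Ss"
  let ?X = "cl [(x, True)]"
  \<comment> \<open>The relator \<open>v x\<^sup>3\<close> forces the cube to be the inverse of
    \<open>v\<close>, and the one with inverse letters forces it to be \<open>v\<close>.\<close>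
  define g where "g = (if b then inv\<^bsub>?G\<^esub> pres_class Xs Rs v else pres_class Xs Rs v)"
  interpret G: group ?G by (rule presented_group_is_group)
  interpret H: group H unfolding H_def by (rule presented_group_is_group)
  have sub: "Xs \<subseteq> insert x Xs" "Rs \<subseteq> ?Ss" by auto
  have wH: "w \<in> words_on (insert x Xs)" if "w \<in> words_on Xs" for w
    using that words_on_mono[OF sub(1)] by blast
  have rel_word: "v @ replicate 3 (x, b) \<in> words_on (insert x Xs)"
    using wH[OF v] by (simp add: numeral_3_eq_3)
  interpret R: root_adjunction ?G g
    by unfold_locales (simp add: g_def v)
  interpret S: group R.NF_sym by (rule group_BijGroup)
  interpret A: group_hom ?G R.NF_sym R.act_perm
    by unfold_locales (rule R.act_perm_hom)
  interpret I: group_hom ?G H \<iota>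
    unfolding H_def \<iota>_def using pres_incl_hom[OF sub] presented_group_is_group
    by (simp add: group_hom_def group_hom_axioms_def)
  have incl: "\<iota> (pres_class Xs Rs w) = cl w" if "w \<in> words_on Xs" for w
    unfolding cl_def \<iota>_def by (rule pres_incl_class[OF sub that])
  have cl_closed: "cl w \<in> carrier H" if "w \<in> words_on (insert x Xs)" for w
    unfolding cl_def H_def using that by simp
  have X: "?X \<in> carrier H" by (rule cl_closed) simp

  define f where "f y = (if y \<in> insert x Xs then cl [(y, True)] else \<one>\<^bsub>H\<^esub>)" for y
  have f: "range f \<subseteq> carrier H" unfolding f_def using cl_closed by auto
  have eval_f: "word_eval H f w = cl w" if "w \<in> words_on (insert x Xs)" for w
    unfolding H_def cl_def by (rule pres_class_eq_word_eval[OF that]) (simp add: f_def cl_def)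
  have "word_eval H f (v @ replicate 3 (x, b)) = \<one>\<^bsub>H\<^esub>"
    unfolding eval_f[OF rel_word] unfolding H_def cl_def
    by (rule pres_class_relator) (use rel_word in auto)
  then have "?X \<otimes>\<^bsub>H\<^esub> ?X \<otimes>\<^bsub>H\<^esub> ?X = (if b then inv\<^bsub>H\<^esub> cl v else cl v)"
    using H.word_eval_cube_relator_iff[OF f] eval_f[OF wH[OF v]] by (simp add: f_def)
  then have cube: "?X \<otimes>\<^bsub>H\<^esub> ?X \<otimes>\<^bsub>H\<^esub> ?X = \<iota> g"
    using v by (simp add: g_def incl)

  \<comment> \<open>The old relators hold because the old generators act through \<open>G\<close>;
    the new one holds because the cube of \<open>root_perm\<close> is
    \<open>act_perm g\<close>.\<close>
  define p where "p y = (if y = x then R.root_perm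
    else if y \<in> Xs then R.act_perm (pres_class Xs Rs [(y, True)]) else \<one>\<^bsub>R.NF_sym\<^esub>)" for y
  have p: "range p \<subseteq> carrier R.NF_sym"
    unfolding p_def using R.root_perm_closed R.act_perm_closed S.one_closed by auto
  have eval_p: "word_eval R.NF_sym p w = R.act_perm (pres_class Xs Rs w)" if "w \<in> words_on Xs" for w
    unfolding hom_pres_class[OF S.is_group R.act_perm_hom that]
    using x by (intro S.word_eval_cong[OF that]) (auto simp: p_def)
  have rels: "word_eval R.NF_sym p r = \<one>\<^bsub>R.NF_sym\<^esub>" if "r \<in> ?Ss" for r
  proof (cases "r \<in> Rs")
    case True
    then have "r \<in> words_on Xs" using Rs by blast
    then show ?thesis
      using True A.hom_one by (simp add: eval_p pres_class_relator del: A.hom_one)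
  next
    case False
    then have r: "r = v @ replicate 3 (x, b)" using that by blast
    have "R.act_perm g = (if b then inv\<^bsub>R.NF_sym\<^esub> word_eval R.NF_sym p v else word_eval R.NF_sym p v)"
      unfolding arg_cong[OF g_def, of R.act_perm] using v by (simp add: eval_p)
    then show ?thesis
      unfolding r S.word_eval_cube_relator_iff[OF p] by (simp add: p_def R.root_perm_cube)
  qed
  let ?\<rho> = "pres_hom R.NF_sym p"
  have rho: "?\<rho> (cl w) = word_eval R.NF_sym p w" if "w \<in> words_on (insert x Xs)" for w
    unfolding cl_def by (rule pres_hom_class[OF S.is_group p rels that])

  interpret root_extension ?G g H \<iota> ?X ?\<rho>
  proof unfold_locales
    show "\<iota> \<in> hom ?G H" by (rule I.homh)
    show "?X \<in> carrier H" by (rule X)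
    show "?X \<otimes>\<^bsub>H\<^esub> ?X \<otimes>\<^bsub>H\<^esub> ?X = \<iota> g" by (rule cube)
    show "?\<rho> \<in> hom H R.NF_sym"
      unfolding H_def by (rule pres_hom_hom[OF S.is_group p rels])
    show "?\<rho> (\<iota> u) = R.act_perm u" if "u \<in> carrier ?G" for u
      using that by (auto elim!: presented_groupE simp: incl rho wH eval_p)
    show "?\<rho> ?X = R.root_perm"
      using R.root_perm_closed by (subst rho) (simp_all add: p_def)
    fix P y
    assume y: "y \<in> carrier H" and one: "P \<one>\<^bsub>H\<^esub>"
      and iota: "\<And>u y. u \<in> carrier ?G \<Longrightarrow> y \<in> carrier H \<Longrightarrow> P y \<Longrightarrow> P (\<iota> u \<otimes>\<^bsub>H\<^esub> y)"
      and root: "\<And>y. y \<in> carrier H \<Longrightarrow> P y \<Longrightarrow> P (?X \<otimes>\<^bsub>H\<^esub> y)"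
    \<comment> \<open>The inverse of \<open>x\<close> is rewritten as \<open>x x\<close> times the
      image of the inverse of \<open>g\<close>, so letters with negative sign reduce to the two
      permitted steps.\<close>
    have invX: "P (inv\<^bsub>H\<^esub> ?X \<otimes>\<^bsub>H\<^esub> y)" if "y \<in> carrier H" "P y" for y
    proof -
      have "inv\<^bsub>H\<^esub> ?X \<otimes>\<^bsub>H\<^esub> (?X \<otimes>\<^bsub>H\<^esub> ?X \<otimes>\<^bsub>H\<^esub> ?X) = ?X \<otimes>\<^bsub>H\<^esub> ?X"
        using X by (simp add: H.m_assoc[symmetric])
      then have "inv\<^bsub>H\<^esub> ?X = ?X \<otimes>\<^bsub>H\<^esub> ?X \<otimes>\<^bsub>H\<^esub> inv\<^bsub>H\<^esub> (\<iota> g)"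
        unfolding cube using X by (subst H.inv_solve_right) simp_all
      then have "inv\<^bsub>H\<^esub> ?X \<otimes>\<^bsub>H\<^esub> y = ?X \<otimes>\<^bsub>H\<^esub> (?X \<otimes>\<^bsub>H\<^esub> (\<iota> (inv\<^bsub>?G\<^esub> g) \<otimes>\<^bsub>H\<^esub> y))"
        using X that by (simp add: H.m_assoc)
      then show ?thesis
        using root[of "?X \<otimes>\<^bsub>H\<^esub> (\<iota> (inv\<^bsub>?G\<^esub> g) \<otimes>\<^bsub>H\<^esub> y)"] root[of "\<iota> (inv\<^bsub>?G\<^esub> g) \<otimes>\<^bsub>H\<^esub> y"]
          iota[of "inv\<^bsub>?G\<^esub> g" y] X that by simp
    qed
    obtain w where w: "w \<in> words_on (insert x Xs)" "y = cl w"
      using y unfolding H_def cl_def by (rule presented_groupE)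
    have "P (cl w)" using w(1)
    proof (induction w)
      case Nil
      then show ?case using one by (simp add: H_def cl_def presented_group_one)
    next
      case (Cons l w)
      obtain z c where l: "l = (z, c)" by force
      have w: "w \<in> words_on (insert x Xs)" and z: "z \<in> insert x Xs" using Cons.hyps l by auto
      have Pw: "P (cl w)" by (rule Cons.IH)
      have split: "cl (l # w) = cl [(z, c)] \<otimes>\<^bsub>H\<^esub> cl w"
        unfolding cl_def H_def using w z by (simp add: presented_group_mult l)
      show ?case
      proof (cases "z = x")
        case True
        have "cl [(x, False)] = inv\<^bsub>H\<^esub> ?X"
          unfolding cl_def H_def by (simp add: presented_group_inv word_inv_def)
        then show ?thesis
          using split root[OF cl_closed[OF w] Pw] invX[OF cl_closed[OF w] Pw] True by (cases c) simp_all
      next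
        case False
        then have "[(z, c)] \<in> words_on Xs" using z by simp
        then show ?thesis
          using split iota[OF _ cl_closed[OF w] Pw, of "pres_class Xs Rs [(z, c)]"] incl[of "[(z, c)]"] by simp
      qed
    qed
    then show "P y" using w by simp
  qed
  show ?thesis
  proof (rule torsion_in_normal[OF N _ N_x y])
    fix u assume u: "u \<in> carrier ?G" "finite_order ?G u"
    then obtain w where "w \<in> words_on Xs" "u = pres_class Xs Rs w" by (auto elim: presented_groupE)
    then show "\<iota> u \<in> N" using N_Xs u by (simp add: incl)
  qed
qed

section \<open>The torsion series\<close>

context group
begin

lemma normal_closure_normal:
  assumes "S \<subseteq> carrier G" shows "normal_closure G S \<lhd> G"
proof (rule normal_invI)
  have "carrier G \<lhd> G" by (intro normal_invI subgroup_self) simp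
  then have "carrier G \<in> {N. N \<lhd> G \<and> S \<subseteq> N}" using assms by simp
  then show "subgroup (normal_closure G S) G"
    unfolding normal_closure_def by (intro subgroups_Inter) (auto dest: normal_imp_subgroup)
  show "x \<otimes> h \<otimes> inv x \<in> normal_closure G S"
    if "x \<in> carrier G" "h \<in> normal_closure G S" for x h
    using that unfolding normal_closure_def by (auto intro: normal.inv_op_closed2)
qed

lemma normal_closure_incl: "S \<subseteq> normal_closure G S"
  unfolding normal_closure_def by blast

lemma normal_closure_min: "N \<lhd> G \<Longrightarrow> S \<subseteq> N \<Longrightarrow> normal_closure G S \<subseteq> N"
  unfolding normal_closure_def by blast

lemma finite_order_Mod_iff:
  assumes "N \<lhd> G" "a \<in> carrier G"
  shows "finite_order (G Mod N) (N #> a) \<longleftrightarrow> (\<exists>k::nat. k > 0 \<and> a [^] k \<in> N)"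
proof -
  have "N #> b = N \<longleftrightarrow> b \<in> N" if "b \<in> carrier G" for b
    using coset_join1[of N b] coset_join2[of b N] that normal_imp_subgroup[OF assms(1)]
      subgroup.subset[of N G] by auto
  then show ?thesis
    unfolding finite_order_def using assms by (simp add: normal.FactGroup_pow)
qed

lemma Tor_normal: "Tor G i \<lhd> G"
  by (cases i) (auto simp: one_is_normal intro: normal_closure_normal)

lemma Tor_Suc:
  "Tor G (Suc i) = normal_closure G {a \<in> carrier G. \<exists>k::nat. k > 0 \<and> a [^] k \<in> Tor G i}"
  using finite_order_Mod_iff[OF Tor_normal] by (auto intro!: arg_cong[where f = "normal_closure G"])

lemma Tor_one: "Tor G 1 = normal_closure G {a \<in> carrier G. finite_order G a}"
  using Tor_Suc[of 0] by (simp add: finite_order_def del: Tor.simps(2))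

end

context group_hom
begin

lemma normal_vimage:
  assumes "N \<lhd> H" shows "{a \<in> carrier G. h a \<in> N} \<lhd> G"
proof (rule G.normal_invI)
  interpret N: normal N H by (rule assms)
  show "subgroup {a \<in> carrier G. h a \<in> N} G"
    by (rule G.subgroupI) auto
  show "x \<otimes> a \<otimes> inv x \<in> {a \<in> carrier G. h a \<in> N}"
    if "x \<in> carrier G" "a \<in> {a \<in> carrier G. h a \<in> N}" for x a
    using that by (simp add: N.inv_op_closed2)
qed

lemma normal_image:
  assumes "N \<lhd> G" "h ` carrier G = carrier H" shows "h ` N \<lhd> H"
proof (rule H.normal_invI)
  interpret N: normal N G by (rule assms(1))
  show "subgroup (h ` N) H" by (rule subgroup_img_is_subgroup[OF N.subgroup_axioms])
  fix y z assume y: "y \<in> carrier H" and z: "z \<in> h ` N"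
  obtain a where "a \<in> carrier G" "y = h a" using y assms(2) by blast
  moreover obtain b where "b \<in> N" "z = h b" using z by blast
  ultimately have ab: "a \<in> carrier G" "y = h a" "b \<in> N" "z = h b" by blast+
  then have "y \<otimes>\<^bsub>H\<^esub> z \<otimes>\<^bsub>H\<^esub> inv\<^bsub>H\<^esub> y = h (a \<otimes> b \<otimes> inv a)" by simp
  moreover have "a \<otimes> b \<otimes> inv a \<in> N" using ab by (simp add: N.inv_op_closed2)
  ultimately show "y \<otimes>\<^bsub>H\<^esub> z \<otimes>\<^bsub>H\<^esub> inv\<^bsub>H\<^esub> y \<in> h ` N" by blast
qed

text \<open>Since one lies in \<open>S\<close>, the preimage of \<open>S\<close> contains the
  kernel. The image of its normal closure is normal by surjectivity and contains \<open>S\<close>;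
  hence an element mapped into the closure of \<open>S\<close> differs from an element of the upper
  closure by a kernel element.\<close>

lemma normal_closure_vimage:
  assumes surj: "h ` carrier G = carrier H" and S: "S \<subseteq> carrier H" "\<one>\<^bsub>H\<^esub> \<in> S"
  shows "normal_closure G {a \<in> carrier G. h a \<in> S} = {a \<in> carrier G. h a \<in> normal_closure H S}"
    (is "?N = ?M")
proof
  show "?N \<subseteq> ?M"
    using H.normal_closure_incl[of S]
    by (intro G.normal_closure_min normal_vimage H.normal_closure_normal S(1)) auto
  have N: "?N \<lhd> G" by (rule G.normal_closure_normal) simp
  interpret N: normal ?N G by (rule N)
  have "S \<subseteq> h ` ?N"
  proof
    fix y assume "y \<in> S"
    moreover then obtain a where "a \<in> carrier G" "y = h a" using surj S by blast
    ultimately show "y \<in> h ` ?N"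
      using G.normal_closure_incl[of "{a \<in> carrier G. h a \<in> S}"] by blast
  qed
  then have image: "normal_closure H S \<subseteq> h ` ?N"
    by (intro H.normal_closure_min normal_image N surj)
  show "?M \<subseteq> ?N"
  proof
    fix a assume "a \<in> ?M"
    then have a: "a \<in> carrier G" "h a \<in> h ` ?N" using image by auto
    then obtain b where b: "b \<in> ?N" "h a = h b" by blast
    then have "h (a \<otimes> inv b) = \<one>\<^bsub>H\<^esub>" using a N.mem_carrier[OF b(1)] by simp
    then have "a \<otimes> inv b \<in> ?N"
      using a N.mem_carrier[OF b(1)] S G.normal_closure_incl[of "{a \<in> carrier G. h a \<in> S}"] by auto
    then have "a \<otimes> inv b \<otimes> b \<in> ?N" using b(1) by (rule N.m_closed)
    then show "a \<in> ?N" using a N.mem_carrier[OF b(1)] by (simp add: G.m_assoc)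
  qed
qed

text \<open>The index shifts by one because the kernel is already the first term. By induction,
  \<open>a\<close> has a positive power in \<open>Tor G (Suc i)\<close> exactly if
  \<open>h a\<close> has one in \<open>Tor H i\<close>, and normal closures pull back along
  \<open>h\<close>.\<close>

lemma Tor_Suc_vimage:
  assumes surj: "h ` carrier G = carrier H" and ker: "Tor G 1 = kernel G H h"
  shows "Tor G (Suc i) = {a \<in> carrier G. h a \<in> Tor H i}"
proof (induction i)
  case 0
  then show ?case using ker by (auto simp: kernel_def simp del: Tor.simps(2))
next
  case (Suc i)
  let ?S = "{a \<in> carrier H. \<exists>k::nat. k > 0 \<and> a [^]\<^bsub>H\<^esub> k \<in> Tor H i}"
  have "{a \<in> carrier G. \<exists>k::nat. k > 0 \<and> a [^] k \<in> Tor G (Suc i)} = {a \<in> carrier G. h a \<in> ?S}"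
    unfolding Suc.IH by (auto simp: hom_nat_pow)
  moreover have "\<one>\<^bsub>H\<^esub> \<in> ?S"
    using subgroup.one_closed[OF normal_imp_subgroup[OF H.Tor_normal[of i]]] by (auto intro: exI[of _ 1])
  then have "normal_closure G {a \<in> carrier G. h a \<in> ?S} = {a \<in> carrier G. h a \<in> normal_closure H ?S}"
    by (intro normal_closure_vimage surj) auto
  ultimately show ?case by (simp only: G.Tor_Suc H.Tor_Suc)
qed

end

text \<open>If the series reaches the whole group, then \<open>Tor_inf\<close> is the whole group,
  so the torsion length is the first index at which this happens.\<close>

lemma TorLen_eqI:
  assumes "group G" "Tor G n = carrier G" "\<And>i. i < n \<Longrightarrow> Tor G i \<noteq> carrier G"
  shows "TorLen G = enat n"
proof -
  have "Tor G i \<subseteq> carrier G" for i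
    using group.Tor_normal[OF assms(1)] normal_imp_subgroup subgroup.subset by blast
  then have "Tor_inf G = carrier G" unfolding Tor_inf_def using assms(2) by blast
  moreover have "(LEAST n. Tor G n = carrier G) = n"
    using assms by (intro Least_equality) (auto simp: not_less[symmetric])
  ultimately show ?thesis unfolding TorLen_def using assms(2) by auto
qed

section \<open>The groups \<open>P\<^sub>n\<close>\<close>

text \<open>The word that the cube of the generator at \<open>\<eta>\<close> is required to equal;
  it is empty at a leaf.\<close>

definition rel_base :: "nat \<Rightarrow> bool list \<Rightarrow> bool list word" where
  "rel_base n \<eta> = (if Suc (length \<eta>) = n then [] else [(\<eta> @ [False], True), (\<eta> @ [True], True)])"

definition relator :: "nat \<Rightarrow> bool list \<Rightarrow> bool list word" where
  "relator n \<eta> = rel_base n \<eta> @ replicate 3 (\<eta>, Suc (length \<eta>) = n)"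

lemma P_rels_eq: "P_rels n = relator n ` P_gens n"
proof -
  have "relator n \<eta> = gen \<eta> @ gen \<eta> @ gen \<eta>" if "length \<eta> + 1 = n" for \<eta>
    using that by (simp add: relator_def rel_base_def gen_def numeral_3_eq_3)
  moreover have "relator n \<eta> = gen (\<eta> @ [False]) @ gen (\<eta> @ [True]) @ gen_inv \<eta> @ gen_inv \<eta> @ gen_inv \<eta>"
    if "length \<eta> + 2 \<le> n" for \<eta>
    using that by (simp add: relator_def rel_base_def gen_def gen_inv_def numeral_3_eq_3)
  moreover have "P_gens n = {\<eta>. length \<eta> + 1 = n} \<union> {\<eta>. length \<eta> + 2 \<le> n}"
    by (auto simp: P_gens_def)
  ultimately show ?thesis
    unfolding P_rels_def by (simp add: image_Un setcompr_eq_image cong: image_cong_simp)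
qed

text \<open>Intermediate group of the construction, with the generators and relators of the vertices
  in \<open>S\<close> only.\<close>

definition stage :: "nat \<Rightarrow> bool list set \<Rightarrow> bool list word set monoid" where
  "stage n S = presented_group S (relator n ` S)"

definition stage_class :: "nat \<Rightarrow> bool list set \<Rightarrow> bool list word \<Rightarrow> bool list word set" where
  "stage_class n S = pres_class S (relator n ` S)"

lemma P_group_eq: "P_group n = stage n (P_gens n)"
  by (simp add: P_group_def P_rels_eq stage_def)

text \<open>Closure under children inside the tree of depth \<open>n\<close>, which makes every
  relator at a vertex of \<open>S\<close> a word over \<open>S\<close>.\<close>

definition tree_closed :: "nat \<Rightarrow> bool list set \<Rightarrow> bool" where
  "tree_closed n S \<longleftrightarrow> S \<subseteq> P_gens n \<and> (\<forall>\<eta>\<in>S. \<forall>c. length \<eta> + 2 \<le> n \<longrightarrow> \<eta> @ [c] \<in> S)"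

lemma tree_closed_P_gens: "tree_closed n (P_gens n)"
  by (auto simp: tree_closed_def P_gens_def)

lemma stage_group: "group (stage n S)"
  by (simp add: stage_def presented_group_is_group)

lemma rel_base_words_on:
  "tree_closed n S \<Longrightarrow> \<eta> \<in> S \<Longrightarrow> rel_base n \<eta> \<in> words_on S"
  by (auto simp: tree_closed_def rel_base_def P_gens_def)

lemma relator_words_on:
  "tree_closed n S \<Longrightarrow> \<eta> \<in> S \<Longrightarrow> relator n \<eta> \<in> words_on S"
  using rel_base_words_on[of n S \<eta>] by (simp add: relator_def numeral_3_eq_3)

lemma stage_class_closed [simp]: "w \<in> words_on S \<Longrightarrow> stage_class n S w \<in> carrier (stage n S)"
  by (simp add: stage_class_def stage_def)

definition satisfies_rels :: "('k, 'm) monoid_scheme \<Rightarrow> (bool list \<Rightarrow> 'k) \<Rightarrow> nat \<Rightarrow> bool list set \<Rightarrow> bool" where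
  "satisfies_rels K f n S \<longleftrightarrow> (\<forall>\<eta>\<in>S. f \<eta> \<otimes>\<^bsub>K\<^esub> f \<eta> \<otimes>\<^bsub>K\<^esub> f \<eta> =
     (if Suc (length \<eta>) = n then \<one>\<^bsub>K\<^esub> else f (\<eta> @ [False]) \<otimes>\<^bsub>K\<^esub> f (\<eta> @ [True])))"

lemma satisfies_rels_iff:
  assumes "group K" "range f \<subseteq> carrier K"
  shows "satisfies_rels K f n S \<longleftrightarrow> (\<forall>r\<in>relator n ` S. word_eval K f r = \<one>\<^bsub>K\<^esub>)"
proof -
  interpret K: group K by (rule assms(1))
  have f: "f x \<in> carrier K" for x using assms(2) by auto
  show ?thesis
    unfolding satisfies_rels_def relator_def using K.word_eval_cube_relator_iff[OF assms(2)]
    by (auto simp: rel_base_def f)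
qed

lemma stage_hom:
  assumes "group K" "range f \<subseteq> carrier K" "satisfies_rels K f n S"
  shows "pres_hom K f \<in> hom (stage n S) K"
    "w \<in> words_on S \<Longrightarrow> pres_hom K f (stage_class n S w) = word_eval K f w"
  using assms pres_hom_hom[of K f "relator n ` S" S] pres_hom_class[of K f "relator n ` S" w S]
  by (auto simp: stage_def stage_class_def satisfies_rels_iff)

lemma stage_satisfies_rels:
  assumes "tree_closed n S"
  shows "satisfies_rels (stage n S)
    (\<lambda>\<eta>. if \<eta> \<in> S then stage_class n S [(\<eta>, True)] else \<one>\<^bsub>stage n S\<^esub>) n S"
    (is "satisfies_rels _ ?f _ _")
proof -
  interpret group "stage n S" by (rule stage_group)
  have "range ?f \<subseteq> carrier (stage n S)" by auto
  moreover have "word_eval (stage n S) ?f r = \<one>\<^bsub>stage n S\<^esub>" if "r \<in> relator n ` S" for r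
  proof -
    have r: "r \<in> words_on S" using that relator_words_on[OF assms] by auto
    then have "word_eval (stage n S) ?f r = stage_class n S r"
      unfolding stage_def stage_class_def by (intro pres_class_eq_word_eval) auto
    then show ?thesis using that r by (simp add: stage_def stage_class_def pres_class_relator)
  qed
  ultimately show ?thesis by (simp add: satisfies_rels_iff[OF stage_group])
qed

lemma stage_relation:
  assumes "tree_closed n S" "\<eta> \<in> S"
  shows "stage_class n S [(\<eta>, True)] \<otimes>\<^bsub>stage n S\<^esub> stage_class n S [(\<eta>, True)] \<otimes>\<^bsub>stage n S\<^esub> stage_class n S [(\<eta>, True)]
    = (if Suc (length \<eta>) = n then \<one>\<^bsub>stage n S\<^esub>
       else stage_class n S [(\<eta> @ [False], True)] \<otimes>\<^bsub>stage n S\<^esub> stage_class n S [(\<eta> @ [True], True)])"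
proof -
  have "\<eta> @ [c] \<in> S" if "Suc (length \<eta>) \<noteq> n" for c
    using assms that by (auto simp: tree_closed_def P_gens_def)
  then show ?thesis
    using stage_satisfies_rels[OF assms(1)] assms(2) unfolding satisfies_rels_def by auto
qed

subsection \<open>Affine maps of the plane\<close>

abbreviation plane :: "(int \<times> int \<Rightarrow> int \<times> int) monoid" where
  "plane \<equiv> BijGroup UNIV"

text \<open>Two rotations of order three whose product is the cube of the translation \<open>shift\<close>.\<close>

definition rot :: "int \<times> int \<Rightarrow> int \<times> int" where "rot = (\<lambda>(p, q). (- q, p - q))"
definition rot' :: "int \<times> int \<Rightarrow> int \<times> int" where "rot' = (\<lambda>(p, q). (q - p + 3, - p))"
definition shift :: "int \<times> int \<Rightarrow> int \<times> int" where "shift = (\<lambda>(p, q). (p, q + 1))"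

lemma plane_carrier_iff: "f \<in> carrier plane \<longleftrightarrow> bij f"
  by (simp add: BijGroup_def Bij_def)

lemma plane_mult: "f \<in> carrier plane \<Longrightarrow> h \<in> carrier plane \<Longrightarrow> f \<otimes>\<^bsub>plane\<^esub> h = f \<circ> h"
  by (simp add: BijGroup_def compose_def fun_eq_iff)

lemma plane_one: "\<one>\<^bsub>plane\<^esub> = id"
  by (simp add: BijGroup_def fun_eq_iff)

text \<open>\<open>rot'\<close> is the inverse of \<open>rot\<close> followed by the translation by
  (3, 0). Conjugating that translation by \<open>rot\<close> gives the translation by (0, 3), and
  the constant 3 makes it a cube in the integral plane.\<close>

lemma rot_cube: "rot \<circ> rot \<circ> rot = id" "rot' \<circ> rot' \<circ> rot' = id"
  and rot_rot': "rot \<circ> rot' = shift \<circ> shift \<circ> shift"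
  by (auto simp: rot_def rot'_def shift_def)

lemma plane_closed [simp]: "rot \<in> carrier plane" "rot' \<in> carrier plane" "shift \<in> carrier plane"
proof -
  have "rot \<circ> (rot \<circ> rot) = id" "(rot \<circ> rot) \<circ> rot = id"
    "rot' \<circ> (rot' \<circ> rot') = id" "(rot' \<circ> rot') \<circ> rot' = id"
    by (auto simp: rot_def rot'_def)
  moreover have "shift \<circ> (\<lambda>(p, q). (p, q - 1)) = id" "(\<lambda>(p, q). (p, q - 1)) \<circ> shift = id"
    by (auto simp: shift_def)
  ultimately show "rot \<in> carrier plane" "rot' \<in> carrier plane" "shift \<in> carrier plane"
    unfolding plane_carrier_iff using o_bij by blast+
qed

lemma plane_relations:
  "rot \<otimes>\<^bsub>plane\<^esub> rot \<otimes>\<^bsub>plane\<^esub> rot = \<one>\<^bsub>plane\<^esub>" "rot' \<otimes>\<^bsub>plane\<^esub> rot' \<otimes>\<^bsub>plane\<^esub> rot' = \<one>\<^bsub>plane\<^esub>"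
  "shift \<otimes>\<^bsub>plane\<^esub> shift \<otimes>\<^bsub>plane\<^esub> shift = rot \<otimes>\<^bsub>plane\<^esub> rot'"
proof -
  interpret group plane by (rule group_BijGroup)
  have "rot \<otimes>\<^bsub>plane\<^esub> rot \<in> carrier plane" "rot' \<otimes>\<^bsub>plane\<^esub> rot' \<in> carrier plane"
    "shift \<otimes>\<^bsub>plane\<^esub> shift \<in> carrier plane" by simp_all
  then show "rot \<otimes>\<^bsub>plane\<^esub> rot \<otimes>\<^bsub>plane\<^esub> rot = \<one>\<^bsub>plane\<^esub>" "rot' \<otimes>\<^bsub>plane\<^esub> rot' \<otimes>\<^bsub>plane\<^esub> rot' = \<one>\<^bsub>plane\<^esub>"
    "shift \<otimes>\<^bsub>plane\<^esub> shift \<otimes>\<^bsub>plane\<^esub> shift = rot \<otimes>\<^bsub>plane\<^esub> rot'"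
    by (simp_all add: plane_mult plane_one rot_cube rot_rot')
qed

lemma rot_not_one: "rot \<noteq> \<one>\<^bsub>plane\<^esub>"
proof
  assume "rot = \<one>\<^bsub>plane\<^esub>"
  then have "rot (0, 1) = (0, 1)" by (simp add: plane_one)
  then show False by (simp add: rot_def)
qed

lemma shift_infinite_order:
  fixes j :: int
  assumes "shift [^]\<^bsub>plane\<^esub> j = \<one>\<^bsub>plane\<^esub>" shows "j = 0"
proof -
  interpret group plane by (rule group_BijGroup)
  have pow: "(shift [^]\<^bsub>plane\<^esub> m) (p, q) = (p, q + int m)" for m :: nat and p q
  proof (induction m arbitrary: q)
    case 0
    then show ?case by (simp add: plane_one)
  next
    case (Suc m)
    then show ?case by (simp add: plane_mult) (simp add: shift_def)
  qed
  have "shift [^]\<^bsub>plane\<^esub> nat \<bar>j\<bar> = \<one>\<^bsub>plane\<^esub>"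
  proof (cases "j < 0")
    case True
    then have "inv\<^bsub>plane\<^esub> (shift [^]\<^bsub>plane\<^esub> nat \<bar>j\<bar>) = \<one>\<^bsub>plane\<^esub>"
      using assms unfolding int_pow_def2 by simp
    then show ?thesis by (simp only: inv_eq_1_iff nat_pow_closed plane_closed)
  next
    case False
    then show ?thesis using assms unfolding int_pow_def2 by simp
  qed
  then show ?thesis using pow[of "nat \<bar>j\<bar>" 0 0] by (simp add: plane_one)
qed

subsection \<open>Torsion\<close>

text \<open>Send the generator at \<open>\<eta>\<close> to \<open>shift\<close>, its children to the
  two rotations and all else to the identity. Minimal length means that \<open>\<eta>\<close> is
  nobody's child in \<open>S\<close>, so every relation at another vertex reads identity equals
  identity. A torsion power of the generator then yields a trivial power of
  \<open>shift\<close>.\<close>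

lemma stage_root_infinite_order:
  fixes k :: int
  assumes S: "tree_closed n S" and \<eta>: "\<eta> \<in> S" and min: "\<And>\<sigma>. \<sigma> \<in> S \<Longrightarrow> length \<eta> \<le> length \<sigma>"
    and inner: "Suc (length \<eta>) \<noteq> n"
    and fin: "finite_order (stage n S) (stage_class n S [(\<eta>, True)] [^]\<^bsub>stage n S\<^esub> k)"
  shows "k = 0"
proof -
  interpret P: group plane by (rule group_BijGroup)
  interpret Q: group "stage n S" by (rule stage_group)
  define f where "f = (\<lambda>_. \<one>\<^bsub>plane\<^esub>)(\<eta> := shift, \<eta> @ [False] := rot, \<eta> @ [True] := rot')"
  have f: "range f \<subseteq> carrier plane" by (auto simp: f_def)
  have "satisfies_rels plane f n S"
    unfolding satisfies_rels_def
  proof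
    fix \<sigma> assume "\<sigma> \<in> S"
    show "f \<sigma> \<otimes>\<^bsub>plane\<^esub> f \<sigma> \<otimes>\<^bsub>plane\<^esub> f \<sigma> =
      (if Suc (length \<sigma>) = n then \<one>\<^bsub>plane\<^esub> else f (\<sigma> @ [False]) \<otimes>\<^bsub>plane\<^esub> f (\<sigma> @ [True]))"
    proof (cases "\<sigma> = \<eta>")
      case True
      then show ?thesis using inner by (simp add: f_def plane_relations)
    next
      case False
      have "\<sigma> @ [c] \<noteq> \<eta>" for c using min[OF \<open>\<sigma> \<in> S\<close>] by auto
      then have "f (\<sigma> @ [c]) = \<one>\<^bsub>plane\<^esub>" for c using False by (simp add: f_def)
      moreover have "f \<sigma> \<otimes>\<^bsub>plane\<^esub> f \<sigma> \<otimes>\<^bsub>plane\<^esub> f \<sigma> = \<one>\<^bsub>plane\<^esub>"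
        using False by (auto simp: f_def plane_relations)
      ultimately show ?thesis by simp
    qed
  qed
  note h = stage_hom[OF group_BijGroup f this]
  interpret h: group_hom "stage n S" plane "pres_hom plane f"
    by unfold_locales (rule h(1))
  let ?X = "stage_class n S [(\<eta>, True)]"
  have X: "?X \<in> carrier (stage n S)" using \<eta> by simp
  obtain m :: nat where m: "m > 0" "(?X [^]\<^bsub>stage n S\<^esub> k) [^]\<^bsub>stage n S\<^esub> m = \<one>\<^bsub>stage n S\<^esub>"
    using fin unfolding finite_order_def by blast
  then have "?X [^]\<^bsub>stage n S\<^esub> (k * int m) = \<one>\<^bsub>stage n S\<^esub>"
    using X by (simp add: Q.int_pow_pow[symmetric] int_pow_int)
  then have "pres_hom plane f ?X [^]\<^bsub>plane\<^esub> (k * int m) = \<one>\<^bsub>plane\<^esub>"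
    using X h.hom_int_pow[of ?X "k * int m"] by simp
  moreover have "pres_hom plane f ?X = shift"
    using \<eta> by (subst h(2)) (simp_all add: f_def)
  ultimately have "k * int m = 0" by (intro shift_infinite_order) simp
  then show ?thesis using m by simp
qed

definition leaf_closure :: "nat \<Rightarrow> bool list set \<Rightarrow> bool list word set set" where
  "leaf_closure n S = normal_closure (stage n S)
     {stage_class n S [(\<eta>, True)] | \<eta>. \<eta> \<in> S \<and> Suc (length \<eta>) = n}"

lemma leaf_closure_normal: "leaf_closure n S \<lhd> stage n S"
  unfolding leaf_closure_def by (rule group.normal_closure_normal[OF stage_group]) auto

lemma leaf_in_closure:
  "\<eta> \<in> S \<Longrightarrow> Suc (length \<eta>) = n \<Longrightarrow> stage_class n S [(\<eta>, True)] \<in> leaf_closure n S"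
  unfolding leaf_closure_def by (rule subsetD[OF group.normal_closure_incl[OF stage_group]]) blast

text \<open>The induced map sends leaves to leaves, so the preimage of the larger closure is normal
  and contains the leaves of the smaller stage.\<close>

lemma leaf_closure_mono:
  assumes "S \<subseteq> T" "w \<in> words_on S" "stage_class n S w \<in> leaf_closure n S"
  shows "stage_class n T w \<in> leaf_closure n T"
proof -
  let ?i = "pres_incl T (relator n ` T)"
  have sub: "S \<subseteq> T" "relator n ` S \<subseteq> relator n ` T" using assms(1) by auto
  have incl: "?i (stage_class n S u) = stage_class n T u" if "u \<in> words_on S" for u
    unfolding stage_class_def by (rule pres_incl_class[OF sub that])
  interpret i: group_hom "stage n S" "stage n T" ?i
    using stage_group pres_incl_hom[OF sub]
    by (simp add: group_hom_def group_hom_axioms_def stage_def)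
  have "leaf_closure n S \<subseteq> {a \<in> carrier (stage n S). ?i a \<in> leaf_closure n T}"
    unfolding leaf_closure_def[of n S]
  proof (rule i.G.normal_closure_min[OF i.normal_vimage[OF leaf_closure_normal]], rule subsetI)
    fix a assume "a \<in> {stage_class n S [(\<eta>, True)] |\<eta>. \<eta> \<in> S \<and> Suc (length \<eta>) = n}"
    then obtain \<eta> where \<eta>: "a = stage_class n S [(\<eta>, True)]" "\<eta> \<in> S" "Suc (length \<eta>) = n" by blast
    then have "stage_class n T [(\<eta>, True)] \<in> leaf_closure n T"
      using sub(1) by (intro leaf_in_closure) auto
    then show "a \<in> {a \<in> carrier (stage n S). ?i a \<in> leaf_closure n T}"
      using \<eta> incl[of "[(\<eta>, True)]"] by simp
  qed
  then show ?thesis using assms incl[of w] by auto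
qed

text \<open>Induction on \<open>card S\<close>, removing a vertex \<open>\<eta>\<close> of minimal
  length. The rest stays closed under children and carries the word
  \<open>rel_base n \<eta>\<close>, so the stage arises by adjoining a cube root. Powers of a leaf
  are in the closure anyway; for an inner vertex only the zeroth power is torsion.\<close>

theorem stage_torsion:
  assumes "finite S" "tree_closed n S" "w \<in> words_on S" "finite_order (stage n S) (stage_class n S w)"
  shows "stage_class n S w \<in> leaf_closure n S"
  using assms
proof (induction "card S" arbitrary: S w rule: less_induct)
  case less
  interpret Q: group "stage n S" by (rule stage_group)
  interpret N: normal "leaf_closure n S" "stage n S" by (rule leaf_closure_normal)
  show ?case
  proof (cases "S = {}")
    case True
    then have "w = []" using less.prems(3) by simp
    then show ?thesis using N.one_closed by (simp add: stage_class_def stage_def presented_group_one)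
  next
    case False
    define \<eta> where "\<eta> = arg_min_on length S"
    have \<eta>: "\<eta> \<in> S" "\<And>\<sigma>. \<sigma> \<in> S \<Longrightarrow> length \<eta> \<le> length \<sigma>"
      using less.prems(1) False arg_min_if_finite[of S length] unfolding \<eta>_def
      by (auto simp: not_less[symmetric])
    define T where "T = S - {\<eta>}"
    have S: "S = insert \<eta> T" "\<eta> \<notin> T" "finite T" "card T < card S"
      using \<eta>(1) less.prems(1) card_Diff1_less[of S \<eta>] by (auto simp: T_def)
    have not_\<eta>: "\<sigma> @ [c] \<noteq> \<eta>" if "\<sigma> \<in> S" for \<sigma> c using \<eta>(2)[OF that] by auto
    have T: "tree_closed n T"
      using less.prems(2) not_\<eta> unfolding tree_closed_def T_def by auto
    have base: "rel_base n \<eta> \<in> words_on T"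
      using \<eta>(1) less.prems(2) not_\<eta>[OF \<eta>(1)] by (auto simp: rel_base_def T_def tree_closed_def P_gens_def)
    have rels: "relator n ` S = insert (rel_base n \<eta> @ replicate 3 (\<eta>, Suc (length \<eta>) = n)) (relator n ` T)"
      by (simp add: S(1) relator_def)
    have eq: "stage n S = presented_group (insert \<eta> T)
        (insert (rel_base n \<eta> @ replicate 3 (\<eta>, Suc (length \<eta>) = n)) (relator n ` T))"
      "stage_class n S = pres_class (insert \<eta> T)
        (insert (rel_base n \<eta> @ replicate 3 (\<eta>, Suc (length \<eta>) = n)) (relator n ` T))"
      unfolding stage_def stage_class_def rels[symmetric] S(1)[symmetric] by simp_all
    show ?thesis
    proof (rule torsion_adjoin_cube_root[OF S(2) _ base, where b = "Suc (length \<eta>) = n"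
          and Rs = "relator n ` T", folded eq])
      show "relator n ` T \<subseteq> words_on T" using relator_words_on[OF T] by auto
      show "leaf_closure n S \<lhd> stage n S" by (rule leaf_closure_normal)
      show "stage_class n S u \<in> leaf_closure n S"
        if "u \<in> words_on T" "finite_order (presented_group T (relator n ` T)) (pres_class T (relator n ` T) u)" for u
        using that S T leaf_closure_mono[of T S u n] less.hyps[of T u]
        by (auto simp: stage_def[symmetric] stage_class_def[symmetric])
      show "stage_class n S [(\<eta>, True)] [^]\<^bsub>stage n S\<^esub> k \<in> leaf_closure n S"
        if "finite_order (stage n S) (stage_class n S [(\<eta>, True)] [^]\<^bsub>stage n S\<^esub> k)" for k :: int
      proof (cases "Suc (length \<eta>) = n")
        case True
        then show ?thesis
          using leaf_in_closure[OF \<eta>(1)] Q.subgroup_int_pow_closed[OF N.subgroup_axioms] by blast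
      next
        case False
        then have "k = 0" using stage_root_infinite_order[OF less.prems(2) \<eta> _ that] by blast
        then show ?thesis using N.one_closed by simp
      qed
    qed (use less.prems in simp_all)
  qed
qed

section \<open>Counting generators and relators\<close>

lemma finite_P_gens: "finite (P_gens n)" and card_P_gens: "card (P_gens n) = 2 ^ n - 1"
proof -
  have eq: "P_gens n = (\<Union>i<n. {\<eta>. length \<eta> = i})" by (auto simp: P_gens_def)
  have fin: "finite {\<eta> :: bool list. length \<eta> = i}" for i
    using finite_lists_length_eq[of "UNIV :: bool set" i] by simp
  show "finite (P_gens n)" unfolding eq using fin by blast
  have "card {\<eta> :: bool list. length \<eta> = i} = 2 ^ i" for i
    using card_lists_length_eq[of "UNIV :: bool set" i] by simp
  then have "card (P_gens n) = (\<Sum>i<n. 2 ^ i)"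
    unfolding eq by (subst card_UN_disjoint) (auto simp: fin)
  also have "\<dots> = 2 ^ n - 1" by (induction n) auto
  finally show "card (P_gens n) = 2 ^ n - 1" .
qed

text \<open>Different vertices give different relators, since the last letter of a relator names its
  vertex.\<close>

lemma card_P_rels: "card (P_rels n) = 2 ^ n - 1"
proof -
  have "last (relator n \<eta>) = (\<eta>, Suc (length \<eta>) = n)" for \<eta>
    by (simp add: relator_def numeral_3_eq_3)
  then have "inj (relator n)" by (metis injI prod.inject)
  then show ?thesis unfolding P_rels_eq by (simp add: card_image inj_on_subset card_P_gens)
qed

lemma P_group_torsion:
  assumes "a \<in> carrier (P_group n)" "finite_order (P_group n) a"
  shows "a \<in> leaf_closure n (P_gens n)"
  using assms stage_torsion[OF finite_P_gens tree_closed_P_gens]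
  unfolding P_group_eq by (auto simp: stage_def stage_class_def elim!: presented_groupE)

lemma Tor_one_P_group: "Tor (P_group n) 1 = leaf_closure n (P_gens n)"
proof -
  interpret group "P_group n" unfolding P_group_eq by (rule stage_group)
  show ?thesis
  proof
    show "Tor (P_group n) 1 \<subseteq> leaf_closure n (P_gens n)"
      unfolding Tor_one using leaf_closure_normal[of n "P_gens n"] P_group_torsion
      by (intro normal_closure_min) (auto simp: P_group_eq)
    have "finite_order (P_group n) (stage_class n (P_gens n) [(\<eta>, True)])"
      if "\<eta> \<in> P_gens n" "Suc (length \<eta>) = n" for \<eta>
    proof -
      have "stage_class n (P_gens n) [(\<eta>, True)] \<in> carrier (P_group n)"
        using that by (simp add: P_group_eq)
      then have "stage_class n (P_gens n) [(\<eta>, True)] [^]\<^bsub>P_group n\<^esub> (3::nat) = \<one>\<^bsub>P_group n\<^esub>"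
        using stage_relation[OF tree_closed_P_gens that(1)] that(2)
        by (simp add: P_group_eq[symmetric] numeral_3_eq_3)
      then show ?thesis unfolding finite_order_def by (intro exI[of _ 3]) simp
    qed
    then have "{stage_class n (P_gens n) [(\<eta>, True)] |\<eta>. \<eta> \<in> P_gens n \<and> Suc (length \<eta>) = n}
        \<subseteq> {a \<in> carrier (P_group n). finite_order (P_group n) a}"
      by (auto simp: P_group_eq)
    also have "\<dots> \<subseteq> Tor (P_group n) 1" unfolding Tor_one by (rule normal_closure_incl)
    finally show "leaf_closure n (P_gens n) \<subseteq> Tor (P_group n) 1"
      unfolding leaf_closure_def P_group_eq[symmetric]
      by (intro normal_closure_min Tor_normal)
  qed
qed

section \<open>Killing the leaves\<close>

text \<open>Assignment from the generators of the next larger group: vertices of length below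
  \<open>m\<close> are kept, and its leaves, which have length exactly \<open>m\<close>, go to
  one.\<close>

definition leaf_kill :: "nat \<Rightarrow> bool list \<Rightarrow> bool list word set" where
  "leaf_kill m \<eta> = (if \<eta> \<in> P_gens m then stage_class m (P_gens m) [(\<eta>, True)] else \<one>\<^bsub>P_group m\<^esub>)"

lemma leaf_kill_closed: "range (leaf_kill m) \<subseteq> carrier (P_group m)"
proof -
  interpret group "P_group m" unfolding P_group_eq by (rule stage_group)
  show ?thesis by (auto simp: leaf_kill_def P_group_eq[symmetric]) (simp add: P_group_eq)
qed

text \<open>The critical vertices have length \<open>m - 1\<close>: they are inner in the larger
  tree, where the cube is a product of two killed leaves, and leaves in the smaller one, where the
  cube is one.\<close>

lemma leaf_kill_satisfies_rels:
  "satisfies_rels (P_group m) (leaf_kill m) (Suc m) (P_gens (Suc m))"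
  unfolding satisfies_rels_def
proof
  interpret group "P_group m" unfolding P_group_eq by (rule stage_group)
  fix \<eta> assume \<eta>: "\<eta> \<in> P_gens (Suc m)"
  show "leaf_kill m \<eta> \<otimes>\<^bsub>P_group m\<^esub> leaf_kill m \<eta> \<otimes>\<^bsub>P_group m\<^esub> leaf_kill m \<eta> =
    (if Suc (length \<eta>) = Suc m then \<one>\<^bsub>P_group m\<^esub>
     else leaf_kill m (\<eta> @ [False]) \<otimes>\<^bsub>P_group m\<^esub> leaf_kill m (\<eta> @ [True]))"
  proof (cases "length \<eta> = m")
    case True
    then show ?thesis by (simp add: leaf_kill_def P_gens_def)
  next
    case False
    then have "\<eta> \<in> P_gens m" using \<eta> by (simp add: P_gens_def)
    moreover from this have "\<eta> @ [c] \<in> P_gens m \<longleftrightarrow> Suc (length \<eta>) \<noteq> m" for c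
      by (auto simp: P_gens_def)
    ultimately show ?thesis
      using False stage_relation[OF tree_closed_P_gens, of \<eta> m]
      by (simp add: leaf_kill_def P_group_eq[symmetric])
  qed
qed

abbreviation collapse :: "nat \<Rightarrow> bool list word set \<Rightarrow> bool list word set" where
  "collapse m \<equiv> pres_hom (P_group m) (leaf_kill m)"

lemma P_group_group: "group (P_group m)"
  unfolding P_group_eq by (rule stage_group)

lemma collapse_hom: "collapse m \<in> hom (P_group (Suc m)) (P_group m)"
  and collapse_class: "w \<in> words_on (P_gens (Suc m)) \<Longrightarrow>
    collapse m (stage_class (Suc m) (P_gens (Suc m)) w) = word_eval (P_group m) (leaf_kill m) w"
  using stage_hom[OF P_group_group leaf_kill_closed leaf_kill_satisfies_rels]
  unfolding P_group_eq[of "Suc m"] by blast+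

lemma collapse_surj: "collapse m ` carrier (P_group (Suc m)) = carrier (P_group m)"
proof
  show "collapse m ` carrier (P_group (Suc m)) \<subseteq> carrier (P_group m)"
    using collapse_hom by (auto simp: hom_def)
  show "carrier (P_group m) \<subseteq> collapse m ` carrier (P_group (Suc m))"
  proof
    fix a assume "a \<in> carrier (P_group m)"
    then obtain w where w: "w \<in> words_on (P_gens m)" "a = stage_class m (P_gens m) w"
      unfolding P_group_eq stage_def stage_class_def by (rule presented_groupE)
    have w': "w \<in> words_on (P_gens (Suc m))"
      by (rule words_on_mono[OF _ w(1)]) (auto simp: P_gens_def)
    have "word_eval (P_group m) (leaf_kill m) w = a"
      unfolding w(2) P_group_eq stage_def stage_class_def
      by (rule pres_class_eq_word_eval[OF w(1)]) (simp add: leaf_kill_def stage_class_def)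
    then have "a = collapse m (stage_class (Suc m) (P_gens (Suc m)) w)"
      using collapse_class[OF w'] by simp
    then show "a \<in> collapse m ` carrier (P_group (Suc m))"
      using w' by (auto simp: P_group_eq)
  qed
qed

text \<open>Leaves are killed, which gives one inclusion. For the other, the quotient by the leaf
  closure satisfies the relations of the smaller group; the resulting map \<open>?h\<close> composed
  with \<open>collapse\<close> is the quotient map, so the kernel of \<open>collapse\<close> lies in
  the closure.\<close>

lemma kernel_collapse:
  "kernel (P_group (Suc m)) (P_group m) (collapse m) = leaf_closure (Suc m) (P_gens (Suc m))"
    (is "?K = ?N")
proof
  let ?G = "P_group (Suc m)" and ?cl = "stage_class (Suc m) (P_gens (Suc m))"
  interpret c: group_hom ?G "P_group m" "collapse m"
    using collapse_hom P_group_group by (simp add: group_hom_def group_hom_axioms_def)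
  have cl: "?cl w \<in> carrier ?G" if "w \<in> words_on (P_gens (Suc m))" for w
    using that by (simp add: P_group_eq)
  show "?N \<subseteq> ?K"
    unfolding leaf_closure_def P_group_eq[symmetric]
  proof (rule c.G.normal_closure_min[OF c.normal_kernel], rule subsetI)
    fix a assume "a \<in> {?cl [(\<eta>, True)] |\<eta>. \<eta> \<in> P_gens (Suc m) \<and> Suc (length \<eta>) = Suc m}"
    then obtain \<eta> where \<eta>: "a = ?cl [(\<eta>, True)]" "\<eta> \<in> P_gens (Suc m)" "length \<eta> = m" by auto
    then have "leaf_kill m \<eta> = \<one>\<^bsub>P_group m\<^esub>" by (simp add: leaf_kill_def P_gens_def)
    then show "a \<in> ?K" using \<eta> cl[of "[(\<eta>, True)]"] by (simp add: kernel_def collapse_class)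
  qed
  have "?N \<lhd> ?G" using leaf_closure_normal by (simp add: P_group_eq)
  then interpret N: normal ?N ?G .
  interpret M: group "?G Mod ?N" by (rule N.factorgroup_is_group)
  interpret q: group_hom ?G "?G Mod ?N" "\<lambda>a. ?N #>\<^bsub>?G\<^esub> a"
    by unfold_locales (rule N.r_coset_hom_Mod)
  have N_eq: "?N #>\<^bsub>?G\<^esub> a = \<one>\<^bsub>?G Mod ?N\<^esub> \<longleftrightarrow> a \<in> ?N" if "a \<in> carrier ?G" for a
    using c.G.coset_join1[of ?N a] c.G.coset_join2[of a ?N] that N.subgroup_axioms N.subset by auto
  define f where "f \<eta> = (if \<eta> \<in> P_gens m then ?N #>\<^bsub>?G\<^esub> ?cl [(\<eta>, True)] else \<one>\<^bsub>?G Mod ?N\<^esub>)" for \<eta>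
  have up: "\<eta> \<in> P_gens (Suc m)" if "\<eta> \<in> P_gens m" for \<eta> using that by (simp add: P_gens_def)
  \<comment> \<open>The default value one agrees with the coset of a leaf, so one formula describes
    \<open>f\<close> on all vertices of the larger tree.\<close>
  have f_leaf: "f \<eta> = ?N #>\<^bsub>?G\<^esub> ?cl [(\<eta>, True)]" if "\<eta> \<in> P_gens (Suc m)" for \<eta>
  proof (cases "\<eta> \<in> P_gens m")
    case False
    then have "?cl [(\<eta>, True)] \<in> ?N" using that by (intro leaf_in_closure) (auto simp: P_gens_def)
    then show ?thesis using False that N_eq[OF cl, of "[(\<eta>, True)]"] by (simp add: f_def)
  qed (simp add: f_def)
  have f: "range f \<subseteq> carrier (?G Mod ?N)"
    using cl up q.hom_closed M.one_closed by (auto simp: f_def simp del: one_FactGroup)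
  have "satisfies_rels (?G Mod ?N) f m (P_gens m)"
    unfolding satisfies_rels_def
  proof
    fix \<eta> assume \<eta>: "\<eta> \<in> P_gens m"
    have c: "\<eta> @ [c] \<in> P_gens (Suc m)" for c using \<eta> by (simp add: P_gens_def)
    have "Suc (length \<eta>) \<noteq> Suc m" using \<eta> by (simp add: P_gens_def)
    then have rel: "?cl [(\<eta>, True)] \<otimes>\<^bsub>?G\<^esub> ?cl [(\<eta>, True)] \<otimes>\<^bsub>?G\<^esub> ?cl [(\<eta>, True)]
        = ?cl [(\<eta> @ [False], True)] \<otimes>\<^bsub>?G\<^esub> ?cl [(\<eta> @ [True], True)]"
      using stage_relation[OF tree_closed_P_gens up[OF \<eta>]] by (simp add: P_group_eq[symmetric])
    have closed: "?cl [(\<sigma>, True)] \<in> carrier ?G" if "\<sigma> \<in> P_gens (Suc m)" for \<sigma>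
      using that by (intro cl) simp
    have "f \<eta> \<otimes>\<^bsub>?G Mod ?N\<^esub> f \<eta> \<otimes>\<^bsub>?G Mod ?N\<^esub> f \<eta> = f (\<eta> @ [False]) \<otimes>\<^bsub>?G Mod ?N\<^esub> f (\<eta> @ [True])"
      unfolding f_leaf[OF up[OF \<eta>]] f_leaf[OF c]
      using arg_cong[OF rel, of "\<lambda>a. ?N #>\<^bsub>?G\<^esub> a"] closed[OF up[OF \<eta>]] closed[OF c]
      by (simp del: mult_FactGroup)
    moreover have "f (\<eta> @ [c]) = \<one>\<^bsub>?G Mod ?N\<^esub>" if "Suc (length \<eta>) = m" for c
      using that by (simp add: f_def P_gens_def)
    ultimately show "f \<eta> \<otimes>\<^bsub>?G Mod ?N\<^esub> f \<eta> \<otimes>\<^bsub>?G Mod ?N\<^esub> f \<eta> =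
        (if Suc (length \<eta>) = m then \<one>\<^bsub>?G Mod ?N\<^esub> else f (\<eta> @ [False]) \<otimes>\<^bsub>?G Mod ?N\<^esub> f (\<eta> @ [True]))"
      by (simp del: mult_FactGroup one_FactGroup)
  qed
  note h = stage_hom[OF M.is_group f this]
  let ?h = "pres_hom (?G Mod ?N) f"
  interpret h: group_hom "P_group m" "?G Mod ?N" ?h
    unfolding P_group_eq[of m] using h(1) stage_group M.is_group
    by (simp add: group_hom_def group_hom_axioms_def)
  \<comment> \<open>Both sides are homomorphisms on the larger group and agree on its generators,
    hence on every word.\<close>
  have comp: "?h (collapse m a) = ?N #>\<^bsub>?G\<^esub> a" if a: "a \<in> carrier ?G" for a
  proof -
    obtain w where w: "w \<in> words_on (P_gens (Suc m))" "a = ?cl w"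
      using a unfolding P_group_eq[of "Suc m"] stage_def stage_class_def by (rule presented_groupE)
    have hc: "(\<lambda>a. ?h (collapse m a)) \<in> hom (presented_group (P_gens (Suc m)) (relator (Suc m) ` P_gens (Suc m))) (?G Mod ?N)"
      using hom_compose[OF collapse_hom h.homh] by (simp add: P_group_eq stage_def comp_def)
    have hq: "(\<lambda>a. ?N #>\<^bsub>?G\<^esub> a) \<in> hom (presented_group (P_gens (Suc m)) (relator (Suc m) ` P_gens (Suc m))) (?G Mod ?N)"
      using q.homh by (simp add: P_group_eq stage_def)
    have "?h (collapse m (?cl [(\<eta>, True)])) = ?N #>\<^bsub>?G\<^esub> ?cl [(\<eta>, True)]" if \<eta>: "\<eta> \<in> P_gens (Suc m)" for \<eta>
    proof -
      have "collapse m (?cl [(\<eta>, True)]) = leaf_kill m \<eta>"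
        using \<eta> subsetD[OF leaf_kill_closed rangeI] by (subst collapse_class) simp_all
      also have "?h (leaf_kill m \<eta>) = f \<eta>"
      proof (cases "\<eta> \<in> P_gens m")
        case True
        then have "?h (stage_class m (P_gens m) [(\<eta>, True)]) = f \<eta>"
          using subsetD[OF f rangeI] by (subst h(2)) (simp_all del: mult_FactGroup one_FactGroup)
        then show ?thesis using True by (simp add: leaf_kill_def)
      next
        case False
        then show ?thesis using h.hom_one by (simp add: leaf_kill_def f_def)
      qed
      also note f_leaf[OF \<eta>]
      finally show ?thesis .
    qed
    then have "word_eval (?G Mod ?N) (\<lambda>\<eta>. ?h (collapse m (?cl [(\<eta>, True)]))) w
        = word_eval (?G Mod ?N) (\<lambda>\<eta>. ?N #>\<^bsub>?G\<^esub> ?cl [(\<eta>, True)]) w"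
      by (rule M.word_eval_cong[OF w(1)])
    then show ?thesis
      using hom_pres_class[OF M.is_group hc w(1), folded stage_class_def]
        hom_pres_class[OF M.is_group hq w(1), folded stage_class_def]
      by (simp only: w(2))
  qed
  show "?K \<subseteq> ?N"
  proof
    fix a assume a: "a \<in> ?K"
    then have "a \<in> carrier ?G" "collapse m a = \<one>\<^bsub>P_group m\<^esub>" by (auto simp: kernel_def)
    then show "a \<in> ?N" using comp N_eq h.hom_one by metis
  qed
qed

section \<open>Nontriviality and torsion length\<close>

text \<open>Send the root to \<open>rot\<close> and the other generators to the identity. All cubes
  are trivial and the root is never a child, so the relations hold.\<close>

lemma P_group_Suc_nontrivial: "carrier (P_group (Suc m)) \<noteq> {\<one>\<^bsub>P_group (Suc m)\<^esub>}"
proof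
  assume triv: "carrier (P_group (Suc m)) = {\<one>\<^bsub>P_group (Suc m)\<^esub>}"
  interpret P: group plane by (rule group_BijGroup)
  define f where "f = (\<lambda>_ :: bool list. \<one>\<^bsub>plane\<^esub>)([] := rot)"
  have f: "range f \<subseteq> carrier plane" by (auto simp: f_def)
  have "satisfies_rels plane f (Suc m) (P_gens (Suc m))"
    unfolding satisfies_rels_def by (simp add: f_def plane_relations)
  note h = stage_hom[OF group_BijGroup f this]
  interpret h: group_hom "P_group (Suc m)" plane "pres_hom plane f"
    using h(1) P_group_group[of "Suc m"] P.is_group
    by (simp add: group_hom_def group_hom_axioms_def P_group_eq)
  let ?x = "stage_class (Suc m) (P_gens (Suc m)) [([], True)]"
  have x: "[([], True)] \<in> words_on (P_gens (Suc m))" by (simp add: P_gens_def)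
  then have "?x = \<one>\<^bsub>P_group (Suc m)\<^esub>" using triv by (metis P_group_eq singletonD stage_class_closed)
  then have "word_eval plane f [([], True)] = \<one>\<^bsub>plane\<^esub>"
    using h(2)[OF x] h.hom_one by simp
  then show False using rot_not_one by (simp add: f_def)
qed

text \<open>\<open>Tor_Suc_vimage\<close> for \<open>collapse\<close> and surjectivity make term
  \<open>Suc i\<close> for \<open>Suc m\<close> the whole group exactly if term \<open>i\<close> for
  \<open>m\<close> is. The remaining term zero is proper by nontriviality.\<close>

lemma Tor_P_group:
  "Tor (P_group n) n = carrier (P_group n) \<and> (\<forall>i<n. Tor (P_group n) i \<noteq> carrier (P_group n))"
proof (induction n)
  case 0
  have "carrier (P_group 0) = {\<one>\<^bsub>P_group 0\<^esub>}"
    by (simp add: P_group_eq stage_def presented_group_carrier presented_group_one P_gens_def)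
  then show ?case by simp
next
  case (Suc m)
  interpret c: group_hom "P_group (Suc m)" "P_group m" "collapse m"
    using collapse_hom P_group_group by (simp add: group_hom_def group_hom_axioms_def)
  have Tor: "Tor (P_group (Suc m)) (Suc i)
      = {a \<in> carrier (P_group (Suc m)). collapse m a \<in> Tor (P_group m) i}" for i
    by (rule c.Tor_Suc_vimage[OF collapse_surj]) (simp only: Tor_one_P_group kernel_collapse)
  have "Tor (P_group (Suc m)) i \<noteq> carrier (P_group (Suc m))" if "i < Suc m" for i
  proof (cases i)
    case 0
    then show ?thesis using P_group_Suc_nontrivial[of m] by auto
  next
    case (Suc j)
    show ?thesis
    proof
      assume "Tor (P_group (Suc m)) i = carrier (P_group (Suc m))"
      then have "collapse m ` carrier (P_group (Suc m)) \<subseteq> Tor (P_group m) j"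
        unfolding Suc Tor by blast
      then have "carrier (P_group m) \<subseteq> Tor (P_group m) j"
        by (simp only: collapse_surj)
      then have "Tor (P_group m) j = carrier (P_group m)"
        using subgroup.subset[OF normal_imp_subgroup[OF c.H.Tor_normal[of j]]] by (rule equalityI[rotated])
      then show False using Suc.IH Suc that by simp
    qed
  qed
  moreover have "Tor (P_group (Suc m)) (Suc m) = carrier (P_group (Suc m))"
    unfolding Tor using Suc.IH c.hom_closed by auto
  ultimately show ?case by blast
qed

theorem theorem4p3:
  fixes n :: nat
  assumes "n \<ge> 1"
  shows "(P_group n Mod Tor (P_group n) 1 \<cong> P_group (n - 1))
       \<and> TorLen (P_group n) = enat n
       \<and> card (P_gens n) = 2 ^ n - 1
       \<and> card (P_rels n) = 2 ^ n - 1"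
proof -
  obtain m where n: "n = Suc m" using assms by (cases n) auto
  interpret c: group_hom "P_group (Suc m)" "P_group m" "collapse m"
    using collapse_hom P_group_group by (simp add: group_hom_def group_hom_axioms_def)
  have "P_group n Mod Tor (P_group n) 1 \<cong> P_group (n - 1)"
    using c.FactGroup_iso[OF collapse_surj] by (simp only: n Tor_one_P_group kernel_collapse diff_Suc_1)
  moreover have "TorLen (P_group n) = enat n"
    using Tor_P_group[of n] by (intro TorLen_eqI P_group_group) auto
  ultimately show ?thesis using card_P_gens card_P_rels by blast
qed

end
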